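(* Let $\alpha,\beta\in\mathbb{R}$ with $\alpha\beta\neq 0$. For $n\in\{2,3,4\}$ let $\Omega_{\mathbb{D}_n}\subset\mathfrak{X}_0^{(\alpha,\beta)}(\mathbb{R}^4)$ be the set of $\mathbb{D}_n$-reversible-equivariant vector fields in $\mathfrak{X}_0^{(\alpha,\beta)}(\mathbb{R}^4)$ (with $\mathbb{D}_2=\mathbb{Z}_2\times\mathbb{Z}_2$). For a linear involution $S$ of $\mathbb{R}^4$ let $\Omega(S)\subset \mathfrak{X}_0^{(\alpha,\beta)}(\mathbb{R}^4)$ be the set of those $X\in\mathfrak{X}_0^{(\alpha,\beta)}(\mathbb{R}^4)$ that are $(R_0,S)$-reversible-equivariant in some coordinate system around the origin. Write $\operatorname{diag}(B,C)$ for the $4\times4$ block diagonal matrix with $2\times 2$ blocks $B,C$, and put $$E=\begin{pmatrix}1&0\\0&-1\end{pmatrix},\quad J=\begin{pmatrix}0&1\\1&0\end{pmatrix},\quad T=\begin{pmatrix}-\tfrac12&\tfrac{\sqrt3}{2}\\ \tfrac{\sqrt3}{2}&\tfrac12\end{pmatrix}.$$ (a) ($n=2$) $\Omega_{\mathbb{Z}_2\times\mathbb{Z}_2}=\Omega(S_1)\cup\Omega(S_2)\cup\Omega(S_3)$, where $S_1=\operatorname{diag}(-E,-E)$, $S_2=\operatorname{diag}(-E,E)$, $S_3=\operatorname{diag}(E,-E)$. (b) ($n=3$) $\Omega_{\mathbb{D}_3}=\Omega(S_1)\cup\Omega(S_2)\cup\Omega(S_3)$, where $S_1=\operatorname{diag}(T,T)$,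 $S_2=\operatorname{diag}(T,E)$, $S_3=\operatorname{diag}(E,T)$. (c) ($n=4$) $\Omega_{\mathbb{D}_4}=\Omega(S_1)\cup\Omega(S_2)\cup\cdots\cup\Omega(S_6)$, where, for each $i\in\{1,\dots,6\}$, $S_i$ is one of the elements of the set $\Xi_i$, with $$\Xi_1=\{\operatorname{diag}(-J,E),\operatorname{diag}(J,E)\},\quad \Xi_2=\{\operatorname{diag}(-E,J),\operatorname{diag}(-E,-J)\},$$ $$\Xi_3=\{\operatorname{diag}(E,J),\operatorname{diag}(E,-J)\},\quad \Xi_4=\{\operatorname{diag}(J,J),\operatorname{diag}(-J,-J)\},$$ $$\Xi_5=\{\operatorname{diag}(J,-E),\operatorname{diag}(-J,-E)\},\quad \Xi_6=\{\operatorname{diag}(J,-J),\operatorname{diag}(-J,J)\}.$$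
   Context: $\mathfrak{X}_0(\mathbb{R}^4)$ is the set of germs at $0$ of $C^\infty$ vector fields on $\mathbb{R}^4$ with an isolated singularity at the origin. For $\alpha\beta\ne0$, $$A(\alpha,\beta)=\begin{pmatrix}0&-\alpha&0&0\\ \alpha&0&0&0\\0&0&0&-\beta\\0&0&\beta&0\end{pmatrix},\qquad \mathfrak{X}_0^{(\alpha,\beta)}(\mathbb{R}^4)=\{X\in\mathfrak{X}_0(\mathbb{R}^4):DX(0)=A(\alpha,\beta)\}.$$ $R_0$ denotes the linear involution $R_0=\operatorname{diag}(1,-1,1,-1)$. A vector field $X$ is reversible with respect to an involutive diffeomorphism germ $\varphi:(\mathbb{R}^4,0)\to(\mathbb{R}^4,0)$ ($\varphi$-reversible) if $D\varphi(x)X(x)=-X(\varphi(x))$, and $\varphi$-equivariant if $D\varphi(x)X(x)=X(\varphi(x))$. Given two involutions $\varphi,\psi$, $X$ is called $(\varphi,\psi)$-reversible-equivariant (or $\langle\varphi,\psi\rangle$-reversible-equivariant, or simply $(\varphi,\psi)$-reversible) if it is reversible with respect to both $\varphi$ and $\psi$ (hence equivariant with respect to $\varphi\psi$). $X$ is $\mathbb{D}_n$-reversible-equivariant if there are $C^\infty$ involutions $\varphi,\psi:(\mathbb{R}^4,0)\to(\mathbb{R}^4,0)$ with $\dim \mathrm{Fix}(\varphi)=\dim \mathrm{Fix}(\psi)=2$ (as local submanifolds), generating a group $\langle\varphi,\psi\rangle$ isomorphic to the dihedral group $\mathbb{D}_n$ of order $2n$, such that $X$ is $\langle\varphi,\psi\rangle$-reversible-equivariant.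 "In some coordinate system around the origin" means after a change of coordinates by a germ of a diffeomorphism fixing $0$. *)

theory Defs
  imports "HOL-Analysis.Analysis" "HOL-Algebra.Generated_Groups"
begin

type_synonym r4 = "real^4"

(* For f to be Ck_on (Suc k) on an open set U, its derivative has to exist on U and all
   directional derivatives have to be Ck_on k; in finite dimension this is the usual C^k. *)
primrec Ck_on :: "nat \<Rightarrow> ('a::real_normed_vector \<Rightarrow> 'b::real_normed_vector) \<Rightarrow> 'a set \<Rightarrow> bool" where
  "Ck_on 0 f U \<longleftrightarrow> continuous_on U f"
| "Ck_on (Suc k) f U \<longleftrightarrow>
     (\<forall>x\<in>U. f differentiable (at x)) \<and>
     (\<forall>v. Ck_on k (\<lambda>x. frechet_derivative f (at x) v) U)"

definition smooth_near_0 :: "(r4 \<Rightarrow> r4) \<Rightarrow> bool" where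
  "smooth_near_0 f \<longleftrightarrow> (\<exists>U. open U \<and> 0 \<in> U \<and> (\<forall>k. Ck_on k f U))"

(* A germ at 0 is the class of all total functions that agree near 0. The predicates below
   are stated for representatives; they depend only on the germs of their arguments. *)
definition germ :: "(r4 \<Rightarrow> r4) \<Rightarrow> (r4 \<Rightarrow> r4) set" where
  "germ f = {g. \<forall>\<^sub>F x in nhds 0. g x = f x}"

definition diffeo_rep :: "(r4 \<Rightarrow> r4) \<Rightarrow> bool" where
  "diffeo_rep f \<longleftrightarrow> smooth_near_0 f \<and> f 0 = 0 \<and>
     (\<exists>g. smooth_near_0 g \<and> g 0 = 0 \<and>
        (\<forall>\<^sub>F x in nhds 0. g (f x) = x) \<and> (\<forall>\<^sub>F x in nhds 0. f (g x) = x))"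

(* On the carrier, all choices of representatives f, g give the same germ of f o g, so the
   union in the multiplication is just that germ. *)
definition diffeo_group :: "(r4 \<Rightarrow> r4) set monoid" where
  "diffeo_group =
     \<lparr>carrier = germ ` {f. diffeo_rep f},
      monoid.mult = (\<lambda>F G. \<Union>f\<in>F. \<Union>g\<in>G. germ (f \<circ> g)),
      one = germ id\<rparr>"

(* (a, False) is the rotation r^a and (a, True) is r^a s, where s r s = r^(-1). *)
definition dihedral_group :: "nat \<Rightarrow> (int \<times> bool) monoid" where
  "dihedral_group n =
     \<lparr>carrier = {0..<int n} \<times> UNIV,
      monoid.mult = (\<lambda>(a, s) (b, t). ((if s then a - b else a + b) mod int n, s \<noteq> t)),
      one = (0, False)\<rparr>"

definition involution_rep :: "(r4 \<Rightarrow> r4) \<Rightarrow> bool" where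
  "involution_rep \<phi> \<longleftrightarrow> diffeo_rep \<phi> \<and> (\<forall>\<^sub>F x in nhds 0. \<phi> (\<phi> x) = x)"

(* Near 0, Fix(\<phi>) is a submanifold through 0 of dimension k: some diffeomorphism germ
   straightens it to a linear subspace. *)
definition fix_has_dim :: "(r4 \<Rightarrow> r4) \<Rightarrow> nat \<Rightarrow> bool" where
  "fix_has_dim \<phi> k \<longleftrightarrow>
     (\<exists>h L. diffeo_rep h \<and> subspace L \<and> dim L = k \<and>
        (\<forall>\<^sub>F x in nhds 0. \<phi> x = x \<longleftrightarrow> h x \<in> L))"

definition reversible :: "(r4 \<Rightarrow> r4) \<Rightarrow> (r4 \<Rightarrow> r4) \<Rightarrow> bool" where
  "reversible \<phi> X \<longleftrightarrow> (\<forall>\<^sub>F x in nhds 0. frechet_derivative \<phi> (at x) (X x) = - X (\<phi> x))"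

definition reversible_equivariant :: "(r4 \<Rightarrow> r4) \<Rightarrow> (r4 \<Rightarrow> r4) \<Rightarrow> (r4 \<Rightarrow> r4) \<Rightarrow> bool" where
  "reversible_equivariant \<phi> \<psi> X \<longleftrightarrow> reversible \<phi> X \<and> reversible \<psi> X"

definition dihedral_reversible_equivariant :: "nat \<Rightarrow> (r4 \<Rightarrow> r4) \<Rightarrow> bool" where
  "dihedral_reversible_equivariant n X \<longleftrightarrow>
     (\<exists>\<phi> \<psi>. involution_rep \<phi> \<and> involution_rep \<psi> \<and>
        fix_has_dim \<phi> 2 \<and> fix_has_dim \<psi> 2 \<and>
        subgroup_generated diffeo_group {germ \<phi>, germ \<psi>} \<cong> dihedral_group n \<and>
        reversible_equivariant \<phi> \<psi> X)"

definition vector_field_rep :: "(r4 \<Rightarrow> r4) \<Rightarrow> bool" where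
  "vector_field_rep X \<longleftrightarrow> smooth_near_0 X \<and> X 0 = 0 \<and> (\<forall>\<^sub>F x in at 0. X x \<noteq> 0)"

definition linear_part :: "real \<Rightarrow> real \<Rightarrow> real^4^4" where
  "linear_part \<alpha> \<beta> = vector
     [vector [0, - \<alpha>, 0, 0],
      vector [\<alpha>, 0, 0, 0],
      vector [0, 0, 0, - \<beta>],
      vector [0, 0, \<beta>, 0]]"

definition vf_reps :: "real \<Rightarrow> real \<Rightarrow> (r4 \<Rightarrow> r4) set" where
  "vf_reps \<alpha> \<beta> =
     {X. vector_field_rep X \<and> (X has_derivative (*v) (linear_part \<alpha> \<beta>)) (at 0)}"

(* Y is X in the coordinates y = h x. This determines the germ of Y. *)
definition in_coordinates :: "(r4 \<Rightarrow> r4) \<Rightarrow> (r4 \<Rightarrow> r4) \<Rightarrow> (r4 \<Rightarrow> r4) \<Rightarrow> bool" where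
  "in_coordinates h X Y \<longleftrightarrow>
     (\<forall>\<^sub>F x in nhds 0. Y (h x) = frechet_derivative h (at x) (X x))"

definition block_diag :: "real^2^2 \<Rightarrow> real^2^2 \<Rightarrow> real^4^4" where
  "block_diag B C = vector
     [vector [B$1$1, B$1$2, 0, 0],
      vector [B$2$1, B$2$2, 0, 0],
      vector [0, 0, C$1$1, C$1$2],
      vector [0, 0, C$2$1, C$2$2]]"

definition R0 :: "real^4^4" where
  "R0 = vector
     [vector [1, 0, 0, 0],
      vector [0, - 1, 0, 0],
      vector [0, 0, 1, 0],
      vector [0, 0, 0, - 1]]"

definition mat_E :: "real^2^2" where
  "mat_E = vector [vector [1, 0], vector [0, - 1]]"

definition mat_J :: "real^2^2" where
  "mat_J = vector [vector [0, 1], vector [1, 0]]"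

definition mat_T :: "real^2^2" where
  "mat_T = vector [vector [- 1 / 2, sqrt 3 / 2], vector [sqrt 3 / 2, 1 / 2]]"

definition Omega_D :: "nat \<Rightarrow> real \<Rightarrow> real \<Rightarrow> (r4 \<Rightarrow> r4) set set" where
  "Omega_D n \<alpha> \<beta> = germ ` {X \<in> vf_reps \<alpha> \<beta>. dihedral_reversible_equivariant n X}"

(* Only X, not its expression Y in the new coordinates, is required to have
   linear part linear_part \<alpha> \<beta>. *)
definition Omega :: "real \<Rightarrow> real \<Rightarrow> real^4^4 \<Rightarrow> (r4 \<Rightarrow> r4) set set" where
  "Omega \<alpha> \<beta> S = germ ` {X \<in> vf_reps \<alpha> \<beta>.
     \<exists>h Y. diffeo_rep h \<and> in_coordinates h X Y \<and> vector_field_rep Y \<and>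
       reversible_equivariant ((*v) R0) ((*v) S) Y}"

end

theory Submission
  imports Defs "HOL-Algebra.Multiplicative_Group"
begin

text \<open>
  The theorem is the linearisation principle for compact group actions, followed by the
  classification of the pairs of linear involutions that can occur.

  Let a vector field \<open>X\<close> with linear part \<open>A\<close> be reversible under the involutions \<open>\<phi>\<close> and \<open>\<psi>\<close>,
  which generate a dihedral group of order \<open>2n\<close>. Two elements of square one that generate a group
  of that order have a product of order exactly \<open>n\<close>
  (\<open>ord_product_of_involutions\<close>), so the group is finite, and averaging over it gives a diffeomorphism
  that conjugates \<open>\<phi>\<close> and \<open>\<psi>\<close> to their derivatives \<open>P\<close> and \<open>Q\<close> at the origin
  (\<open>linearize_two_involutions\<close>). Differentiating the reversibility equations shows that \<open>P\<close> and \<open>Q\<close>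
  anticommute with \<open>A\<close>, and \<open>A\<close> is invertible because \<open>\<alpha> * \<beta> \<noteq> 0\<close>.

  It remains to normalise a pair of linear involutions that anticommute with an invertible map and
  whose product \<open>W = P Q\<close> has order \<open>n\<close>. The space splits into the kernels of the irreducible factors
  of \<open>W^n - 1\<close>. Each of them is invariant under \<open>P\<close> and \<open>Q\<close>, and under \<open>A\<close>, which exchanges the
  two eigenspaces of \<open>P\<close>; hence each kernel has even dimension, and half of it is fixed by \<open>P\<close>. A vector
  fixed by \<open>P\<close> in such a kernel is completed to a plane on which \<open>P\<close> is \<open>mat_E\<close> and \<open>Q\<close> is one of the
  reflections of the statement, and \<open>\<real>\<^sup>4\<close> is the sum of two such planes
  (\<open>classify_order_2\<close>, \<open>classify_order_3\<close>, \<open>classify_order_4\<close>). The order of the two planes and the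
  sign of \<open>mat_J\<close> can be chosen at will, so the unions of the statement repeat some sets: three of the six
  matrices already suffice for \<open>n = 4\<close>, and two of the three for \<open>n = 2\<close> and \<open>n = 3\<close>.

  Conversely, a pair \<open>R0\<close>, \<open>S\<close> acting in some coordinates is transported back by the coordinate
  change. The two involutions so obtained generate a dihedral group because \<open>R0 S\<close> has order \<open>n\<close>, and
  their fixed sets are planes because \<open>R0\<close> and \<open>S\<close> anticommute with the invertible linear part of the
  field.

  All of this rests on a calculus for the inductively defined \<open>C\<^sup>k\<close> functions, up to the smoothness of
  local inverses.
\<close>

section \<open>Calculus of continuously differentiable functions\<close>

lemma Ck_on_cong:
  assumes "open U" "\<And>x. x \<in> U \<Longrightarrow> f x = g x" "Ck_on k f U"
  shows "Ck_on k g U"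
  using assms(2,3)
proof (induction k arbitrary: f g)
  case 0
  then show ?case by (auto cong: continuous_on_cong)
next
  case (Suc k)
  have d: "f differentiable at x" if "x \<in> U" for x
    using Suc.prems that by simp
  have e: "frechet_derivative f (at x) v = frechet_derivative g (at x) v" if "x \<in> U" for x v
    using frechet_derivative_transform_within_open[OF d[OF that] \<open>open U\<close> that] Suc.prems(1) by metis
  have "g differentiable at x" if "x \<in> U" for x
    using d[OF that] Suc.prems(1) \<open>open U\<close> that
    by (meson differentiable_def has_derivative_transform_within_open)
  moreover have "Ck_on k (\<lambda>x. frechet_derivative g (at x) v) U" for v
    by (rule Suc.IH[OF e]) (use Suc.prems(2) in auto)
  ultimately show ?case by simp
qed

lemma Ck_on_subset: "Ck_on k f U \<Longrightarrow> V \<subseteq> U \<Longrightarrow> Ck_on k f V"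
  by (induction k arbitrary: f) (auto intro: continuous_on_subset)

lemma Ck_on_SucI:
  assumes "open U" "\<And>x. x \<in> U \<Longrightarrow> (f has_derivative f' x) (at x)"
    and "\<And>v. Ck_on k (\<lambda>x. f' x v) U"
  shows "Ck_on (Suc k) f U"
proof -
  have "f' x v = frechet_derivative f (at x) v" if "x \<in> U" for x v
    using frechet_derivative_at[OF assms(2)[OF that]] by simp
  then show ?thesis
    using assms Ck_on_cong[OF assms(1) _ assms(3)] by (auto simp: differentiable_def)
qed

lemma Ck_on_SucD:
  assumes "Ck_on (Suc k) f U" "x \<in> U"
  shows "(f has_derivative frechet_derivative f (at x)) (at x)"
  using assms by (auto simp: frechet_derivative_works)

lemma Ck_on_Suc_imp: "Ck_on (Suc k) f U \<Longrightarrow> Ck_on k f U"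
proof (induction k arbitrary: f)
  case 0
  then have "isCont f x" if "x \<in> U" for x
    using that by (auto intro: differentiable_imp_continuous_within)
  then show ?case by (simp add: continuous_at_imp_continuous_on)
next
  case (Suc k)
  show ?case
    unfolding Ck_on.simps(2)[of k] using Suc.prems Suc.IH
    by (auto simp del: Ck_on.simps simp add: Ck_on.simps(2)[of "Suc k"])
qed

lemma Ck_on_const: "open U \<Longrightarrow> Ck_on k (\<lambda>x. c) U"
proof (induction k arbitrary: c)
  case (Suc k)
  show ?case by (rule Ck_on_SucI[OF Suc.prems has_derivative_const Suc.IH[OF Suc.prems]])
qed simp

lemma Ck_on_add:
  assumes "open U" "Ck_on k f U" "Ck_on k g U"
  shows "Ck_on k (\<lambda>x. f x + g x) U"
  using assms(2,3)
proof (induction k arbitrary: f g)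
  case 0 then show ?case by (auto intro: continuous_on_add)
next
  case (Suc k)
  show ?case
    by (rule Ck_on_SucI[OF assms(1) has_derivative_add[OF Ck_on_SucD[OF Suc.prems(1)] Ck_on_SucD[OF Suc.prems(2)]]])
      (use Suc in auto)
qed

lemma Ck_on_linear_compose:
  assumes "open U" "bounded_linear l" "Ck_on k f U"
  shows "Ck_on k (\<lambda>x. l (f x)) U"
  using assms(3)
proof (induction k arbitrary: f)
  case 0 then show ?case using bounded_linear.continuous_on[OF assms(2)] by auto
next
  case (Suc k)
  show ?case
    by (rule Ck_on_SucI[OF assms(1) bounded_linear.has_derivative[OF assms(2) Ck_on_SucD[OF Suc.prems]]])
      (use Suc in auto)
qed

lemma Ck_on_bilinear:
  assumes "open U" "bounded_bilinear b" "Ck_on k f U" "Ck_on k g U"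
  shows "Ck_on k (\<lambda>x. b (f x) (g x)) U"
  using assms(3,4)
proof (induction k arbitrary: f g)
  case 0 then show ?case using bounded_bilinear.continuous_on[OF assms(2)] by auto
next
  case (Suc k)
  note c = Ck_on_Suc_imp[OF Suc.prems(1)] Ck_on_Suc_imp[OF Suc.prems(2)]
  show ?case
    by (rule Ck_on_SucI[OF assms(1) bounded_bilinear.FDERIV[OF assms(2) Ck_on_SucD[OF Suc.prems(1)] Ck_on_SucD[OF Suc.prems(2)]]])
      (use Suc c in \<open>auto intro!: Ck_on_add[OF assms(1)]\<close>)
qed

lemma Ck_on_id: "open U \<Longrightarrow> Ck_on k (\<lambda>x. x) U"
proof (cases k)
  case (Suc m)
  assume "open U"
  show ?thesis unfolding Suc
    by (rule Ck_on_SucI[OF \<open>open U\<close> has_derivative_ident Ck_on_const[OF \<open>open U\<close>]])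
qed simp

lemma Ck_on_linear: "open U \<Longrightarrow> bounded_linear l \<Longrightarrow> Ck_on k l U"
  using Ck_on_linear_compose[OF _ _ Ck_on_id] by blast

lemma Ck_on_sum:
  assumes "open U" "\<And>i. i \<in> I \<Longrightarrow> Ck_on k (f i) U"
  shows "Ck_on k (\<lambda>x. \<Sum>i\<in>I. f i x) U"
  using assms(2)
  by (induction I rule: infinite_finite_induct)
    (simp_all add: Ck_on_const[OF assms(1)] Ck_on_add[OF assms(1)])

lemma Ck_on_prod:
  fixes f :: "'i \<Rightarrow> 'a::real_normed_vector \<Rightarrow> real"
  assumes "open U" "\<And>i. i \<in> I \<Longrightarrow> Ck_on k (f i) U"
  shows "Ck_on k (\<lambda>x. \<Prod>i\<in>I. f i x) U"
  using assms(2)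
  by (induction I rule: infinite_finite_induct)
    (simp_all add: Ck_on_const[OF assms(1)] Ck_on_bilinear[OF assms(1) bounded_bilinear_mult])

lemma Ck_on_inverse:
  fixes f :: "'a::real_normed_vector \<Rightarrow> real"
  assumes "open U" "Ck_on k f U" "\<And>x. x \<in> U \<Longrightarrow> f x \<noteq> 0"
  shows "Ck_on k (\<lambda>x. inverse (f x)) U"
  using assms(2)
proof (induction k)
  case 0 then show ?case using assms(3) by (auto intro: continuous_on_inverse)
next
  case (Suc k)
  note i = Suc.IH[OF Ck_on_Suc_imp[OF Suc.prems]]
  have d: "Ck_on k (\<lambda>x. frechet_derivative f (at x) v) U" for v using Suc.prems by simp
  note mult = Ck_on_bilinear[OF assms(1) bounded_bilinear_mult]
  have "Ck_on k (\<lambda>x. - (inverse (f x) * frechet_derivative f (at x) v * inverse (f x))) U" for v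
    by (rule Ck_on_linear_compose[OF assms(1) bounded_linear_minus[OF bounded_linear_ident]], rule mult[OF mult[OF i d] i])
  then show ?case
    using Ck_on_SucI[OF assms(1) Deriv.has_derivative_inverse[OF assms(3) Ck_on_SucD[OF Suc.prems]]] by blast
qed

text \<open>
  A family of linear maps is smooth as soon as its values on fixed vectors are, because the argument
  expands in a basis. This is what lets the chain rule be iterated: the derivative of \<open>f \<circ> g\<close> is the
  derivative of \<open>f\<close>, known only in fixed directions, applied to a moving vector.
\<close>

lemma Ck_on_apply:
  fixes g :: "'a::real_normed_vector \<Rightarrow> 'b::euclidean_space"
  assumes "open U" "\<And>x. x \<in> U \<Longrightarrow> linear (l x)" "\<And>v. Ck_on k (\<lambda>x. l x v) U" "Ck_on k g U"
  shows "Ck_on k (\<lambda>x. l x (g x)) U"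
proof (rule Ck_on_cong[OF assms(1)])
  show "Ck_on k (\<lambda>x. \<Sum>b\<in>Basis. (g x \<bullet> b) *\<^sub>R l x b) U"
    by (rule Ck_on_sum[OF assms(1)], rule Ck_on_bilinear[OF assms(1) bounded_bilinear_scaleR
      Ck_on_linear_compose[OF assms(1) bounded_linear_inner_left assms(4)] assms(3)])
  show "(\<Sum>b\<in>Basis. (g x \<bullet> b) *\<^sub>R l x b) = l x (g x)" if "x \<in> U" for x
    using linear_sum[OF assms(2)[OF that], of "\<lambda>b. (g x \<bullet> b) *\<^sub>R b" Basis]
    by (simp add: euclidean_representation linear_scale[OF assms(2)[OF that]])
qed

lemma Ck_on_compose:
  fixes g :: "'a::real_normed_vector \<Rightarrow> 'b::euclidean_space"
  assumes "open U" "open V" "g ` U \<subseteq> V" "Ck_on k f V" "Ck_on k g U"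
  shows "Ck_on k (\<lambda>x. f (g x)) U"
  using assms(4,5)
proof (induction k arbitrary: f)
  case 0 then show ?case using assms(3) by (auto intro: continuous_on_compose2)
next
  case (Suc k)
  have c: "((\<lambda>x. f (g x)) has_derivative
      (\<lambda>v. frechet_derivative f (at (g x)) (frechet_derivative g (at x) v))) (at x)" if "x \<in> U" for x
    using diff_chain_at[OF Ck_on_SucD[OF Suc.prems(2) that] Ck_on_SucD[OF Suc.prems(1)]] assms(3) that
    by (auto simp: o_def)
  show ?case
  proof (rule Ck_on_SucI[OF assms(1) c])
    fix v
    show "Ck_on k (\<lambda>x. frechet_derivative f (at (g x)) (frechet_derivative g (at x) v)) U"
    proof (rule Ck_on_apply[OF assms(1)])
      show "linear (frechet_derivative f (at (g x)))" if "x \<in> U" for x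
        using Ck_on_SucD[OF Suc.prems(1), of "g x"] assms(3) that by (auto intro: has_derivative_linear)
      show "Ck_on k (\<lambda>x. frechet_derivative f (at (g x)) v) U" for v
        by (rule Suc.IH) (use Suc.prems Ck_on_Suc_imp in auto)
      show "Ck_on k (\<lambda>x. frechet_derivative g (at x) v) U" using Suc.prems by simp
    qed
  qed
qed

lemma Ck_on_componentwise:
  fixes f :: "'a::real_normed_vector \<Rightarrow> real^'n"
  assumes "open U" "\<And>i. Ck_on k (\<lambda>x. f x $ i) U"
  shows "Ck_on k f U"
proof (rule Ck_on_cong[OF assms(1)])
  show "Ck_on k (\<lambda>x. \<Sum>i\<in>UNIV. (f x $ i) *\<^sub>R axis i (1::real)) U"
    by (rule Ck_on_sum[OF assms(1)], rule Ck_on_bilinear[OF assms(1) bounded_bilinear_scaleR assms(2) Ck_on_const[OF assms(1)]])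
  show "(\<Sum>i\<in>UNIV. (f x $ i) *\<^sub>R axis i (1::real)) = f x" for x
    using basis_expansion[of "f x"] by (simp add: scalar_mult_eq_scaleR)
qed

lemma Ck_on_det:
  fixes A :: "'a::real_normed_vector \<Rightarrow> real^'n^'n"
  assumes "open U" "\<And>i j. Ck_on k (\<lambda>x. A x $ i $ j) U"
  shows "Ck_on k (\<lambda>x. det (A x)) U"
  unfolding det_def
  by (intro Ck_on_sum Ck_on_bilinear[OF _ bounded_bilinear_mult] Ck_on_prod Ck_on_const assms)

text \<open>
  Cramer's rule expresses the solution of a linear system as a quotient of polynomials in the
  coefficients.
\<close>

lemma Ck_on_solution:
  fixes A :: "'a::real_normed_vector \<Rightarrow> real^'n^'n" and u :: "'a \<Rightarrow> real^'n"
  assumes "open U" "\<And>i j. Ck_on k (\<lambda>x. A x $ i $ j) U"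
    and "\<And>x. x \<in> U \<Longrightarrow> det (A x) \<noteq> 0" "\<And>x. x \<in> U \<Longrightarrow> A x *v u x = b"
  shows "Ck_on k u U"
proof (rule Ck_on_cong[OF assms(1)])
  let ?B = "\<lambda>l x. (\<chi> i j. if j = l then b$i else A x$i$j) :: real^'n^'n"
  show "Ck_on k (\<lambda>x. \<chi> l. det (?B l x) * inverse (det (A x))) U"
  proof (rule Ck_on_componentwise[OF assms(1)])
    fix l
    have "Ck_on k (\<lambda>x. ?B l x $ i $ j) U" for i j
      using assms(2)[of i j] Ck_on_const[OF assms(1), of k "b$i"] by (cases "j = l") auto
    then show "Ck_on k (\<lambda>x. (\<chi> l. det (?B l x) * inverse (det (A x))) $ l) U"
      by (simp, intro Ck_on_bilinear[OF assms(1) bounded_bilinear_mult] Ck_on_det Ck_on_inverse assms)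
         (simp_all)
  qed
  show "(\<chi> l. det (?B l x) * inverse (det (A x))) = u x" if "x \<in> U" for x
    using assms(4)[OF that] cramer[OF assms(3)[OF that], of "u x" b]
    by (simp add: divide_inverse)
qed

text \<open>
  The usual bootstrap: the derivative of \<open>g\<close> in direction \<open>v\<close> solves the linear system whose matrix is
  the derivative of \<open>f\<close> along \<open>g\<close>, so it is as smooth as \<open>g\<close> itself, which gains one order.
\<close>

lemma Ck_on_local_inverse:
  fixes f g :: "real^'n \<Rightarrow> real^'n"
  assumes "open U" "open V" "g ` V \<subseteq> U" "Ck_on k f U"
    and der: "\<And>y. y \<in> V \<Longrightarrow> (g has_derivative g' y) (at y)"
    and inv: "\<And>y v. y \<in> V \<Longrightarrow> frechet_derivative f (at (g y)) (g' y v) = v"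
    and bij: "\<And>y. y \<in> V \<Longrightarrow> bij (frechet_derivative f (at (g y)))"
    and cont: "continuous_on V g"
  shows "Ck_on k g V"
  using assms(4)
proof (induction k)
  case 0 then show ?case using cont by simp
next
  case (Suc k)
  have gk: "Ck_on k g V" using Suc.IH Ck_on_Suc_imp[OF Suc.prems] by blast
  define A where "A y = matrix (frechet_derivative f (at (g y)))" for y
  have lin: "linear (frechet_derivative f (at (g y)))" if "y \<in> V" for y
    using Ck_on_SucD[OF Suc.prems, of "g y"] assms(3) that by (auto intro: has_derivative_linear)
  have A: "A y *v v = frechet_derivative f (at (g y)) v" if "y \<in> V" for y v
    unfolding A_def using matrix_works[OF lin[OF that, unfolded linear_matrix_vector_mul_eq[symmetric]]] by metis
  show ?case
  proof (rule Ck_on_SucI[OF assms(2) der])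
    fix v
    show "Ck_on k (\<lambda>x. g' x v) V"
    proof (rule Ck_on_solution[OF assms(2)])
      show "Ck_on k (\<lambda>x. A x $ i $ j) V" for i j
      proof -
        have "Ck_on k (\<lambda>x. frechet_derivative f (at (g x)) (axis j 1)) V"
          by (rule Ck_on_compose[OF assms(2,1,3) _ gk]) (use Suc.prems in simp)
        from Ck_on_linear_compose[OF assms(2) bounded_linear_vec_nth this]
        show ?thesis by (simp add: A_def matrix_def)
      qed
      show "A x *v g' x v = v" if "x \<in> V" for x
        using A inv that by simp
      show "det (A x) \<noteq> 0" if "x \<in> V" for x
        using bij[OF that] det_nz_iff_inj[OF lin[OF that]] by (simp add: A_def bij_def)
    qed
  qed
qed

section \<open>Germs of smooth maps and of diffeomorphisms\<close>

abbreviation D :: "(r4 \<Rightarrow> r4) \<Rightarrow> r4 \<Rightarrow> r4 \<Rightarrow> r4"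
  where "D f x \<equiv> frechet_derivative f (at x)"

lemma smooth_near_0_linear: "linear l \<Longrightarrow> smooth_near_0 l"
  unfolding smooth_near_0_def using Ck_on_linear[of UNIV l] by (auto simp: linear_conv_bounded_linear)

lemma smooth_near_0_Int:
  assumes "smooth_near_0 f" "smooth_near_0 g"
  obtains U where "open U" "0 \<in> U" "\<And>k. Ck_on k f U" "\<And>k. Ck_on k g U"
proof -
  obtain U V where "open U" "0 \<in> U" "\<forall>k. Ck_on k f U" "open V" "0 \<in> V" "\<forall>k. Ck_on k g V"
    using assms unfolding smooth_near_0_def by auto
  then show ?thesis
    using that[of "U \<inter> V"] by (meson Ck_on_subset Int_iff Int_lower1 Int_lower2 open_Int)
qed

lemma smooth_near_0_add:
  assumes "smooth_near_0 f" "smooth_near_0 g"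
  shows "smooth_near_0 (\<lambda>x. f x + g x)"
  using smooth_near_0_Int[OF assms] Ck_on_add unfolding smooth_near_0_def by metis

lemma smooth_near_0_sum:
  assumes "\<And>i. i \<in> I \<Longrightarrow> smooth_near_0 (f i)"
  shows "smooth_near_0 (\<lambda>x. \<Sum>i\<in>I. f i x)"
  using assms
  by (induction I rule: infinite_finite_induct)
    (simp_all add: smooth_near_0_linear linear_zero smooth_near_0_add)

lemma smooth_near_0_compose:
  assumes "smooth_near_0 f" "smooth_near_0 g" "g 0 = 0"
  shows "smooth_near_0 (\<lambda>x. f (g x))"
proof -
  obtain U where U: "open U" "0 \<in> U" "\<And>k. Ck_on k f U"
    using assms(1) unfolding smooth_near_0_def by blast
  obtain V where V: "open V" "0 \<in> V" "\<And>k. Ck_on k g V"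
    using assms(2) unfolding smooth_near_0_def by blast
  have "open (V \<inter> g -` U)"
    using V(3)[of 0] by (auto intro!: continuous_open_preimage U V)
  moreover have "Ck_on k (\<lambda>x. f (g x)) (V \<inter> g -` U)" for k
    by (rule Ck_on_compose[OF calculation U(1) _ U(3) Ck_on_subset[OF V(3)]]) auto
  ultimately show ?thesis
    unfolding smooth_near_0_def using U V assms(3) by (intro exI[of _ "V \<inter> g -` U"]) auto
qed

lemma smooth_near_0_has_derivative:
  assumes "smooth_near_0 f"
  shows "\<forall>\<^sub>F x in nhds 0. (f has_derivative D f x) (at x)"
proof -
  obtain U where U: "open U" "0 \<in> U" "\<And>k. Ck_on k f U"
    using assms unfolding smooth_near_0_def by blast
  have "(f has_derivative D f x) (at x)" if "x \<in> U" for x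
    by (rule Ck_on_SucD[OF U(3) that])
  with U show ?thesis unfolding eventually_nhds by blast
qed

lemma smooth_near_0_has_derivative_0: "smooth_near_0 f \<Longrightarrow> (f has_derivative D f 0) (at 0)"
  using smooth_near_0_has_derivative eventually_nhds_x_imp_x by blast

lemma smooth_near_0_linear_D: "smooth_near_0 f \<Longrightarrow> linear (D f 0)"
  using smooth_near_0_has_derivative_0 has_derivative_linear by blast

lemma smooth_near_0_D_apply:
  assumes "smooth_near_0 f" "smooth_near_0 g"
  shows "smooth_near_0 (\<lambda>x. D f x (g x))"
proof -
  obtain U where U: "open U" "0 \<in> U" "\<And>k. Ck_on k f U" "\<And>k. Ck_on k g U"
    using smooth_near_0_Int[OF assms] by blast
  have "Ck_on k (\<lambda>x. D f x (g x)) U" for k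
  proof (rule Ck_on_apply[where l = "D f" and g = g, OF U(1)])
    show "linear (D f x)" if "x \<in> U" for x
      by (rule has_derivative_linear[OF Ck_on_SucD[OF U(3) that]])
    show "Ck_on k (\<lambda>x. D f x v) U" for v
      using U(3)[of "Suc k"] by simp
  qed (rule U)
  then show ?thesis unfolding smooth_near_0_def using U by blast
qed

lemma smooth_near_0_tendsto:
  assumes "smooth_near_0 f" "f 0 = 0"
  shows "filterlim f (nhds 0) (nhds 0)"
  using has_derivative_continuous[OF smooth_near_0_has_derivative_0[OF assms(1)]] assms(2)
  by (metis continuous_at tendsto_at_iff_tendsto_nhds)

lemma eventually_nhds_0_compose:
  assumes "smooth_near_0 f" "f 0 = 0" "\<forall>\<^sub>F x in nhds 0. P x"
  shows "\<forall>\<^sub>F x in nhds 0. P (f x)"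
  using smooth_near_0_tendsto[OF assms(1,2)] assms(3) by (simp add: filterlim_iff)

text \<open>
  The derivatives agree not only at the origin but at all nearby points, which is what the
  equations of reversibility need.
\<close>

lemma D_cong:
  assumes "\<forall>\<^sub>F x in nhds 0. f x = g x"
  shows "\<forall>\<^sub>F x in nhds 0. D f x = D g x"
proof -
  have "D f x = D g x" if "\<forall>\<^sub>F y in nhds x. f y = g y" for x
  proof -
    have *: "(u has_derivative u') (at x) \<Longrightarrow> \<forall>\<^sub>F y in nhds x. u y = v y \<Longrightarrow> (v has_derivative u') (at x)"
      for u v :: "r4 \<Rightarrow> r4" and u'
      using has_derivative_transform_eventually[of u u' x UNIV v] eventually_nhds_x_imp_x
      by (auto simp: eventually_nhds_conv_at)
    have "\<forall>\<^sub>F y in nhds x. g y = f y" using that by eventually_elim simp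
    then have "(f has_derivative f') (at x) \<longleftrightarrow> (g has_derivative f') (at x)" for f'
      using *[OF _ that] *[of g _ f] by blast
    then show ?thesis by (simp add: frechet_derivative_def)
  qed
  then show ?thesis
    using assms by (subst (asm) eventually_eventually[symmetric]) (auto elim: eventually_mono)
qed

lemma D_chain:
  assumes "smooth_near_0 f" "smooth_near_0 g" "g 0 = 0"
  shows "\<forall>\<^sub>F x in nhds 0. D (\<lambda>x. f (g x)) x = (\<lambda>v. D f (g x) (D g x v))"
  using smooth_near_0_has_derivative[OF assms(2)]
    eventually_nhds_0_compose[OF assms(2,3) smooth_near_0_has_derivative[OF assms(1)]]
proof eventually_elim
  case (elim x)
  show ?case
    using frechet_derivative_at[OF diff_chain_at[OF elim]] by (simp add: o_def)
qed

lemma D_chain_0: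
  assumes "smooth_near_0 f" "smooth_near_0 g" "g 0 = 0"
  shows "D (\<lambda>x. f (g x)) 0 v = D f 0 (D g 0 v)"
  using eventually_nhds_x_imp_x[OF D_chain[OF assms]] assms(3) by simp

lemma D_cong_0: "\<forall>\<^sub>F x in nhds 0. f x = g x \<Longrightarrow> D f 0 = D g 0"
  using eventually_nhds_x_imp_x[OF D_cong] .

lemma D_linear: "linear l \<Longrightarrow> D l x = l"
  using frechet_derivative_at[OF linear_imp_has_derivative] by metis

lemma diffeo_rep_smooth: "diffeo_rep f \<Longrightarrow> smooth_near_0 f"
  and diffeo_rep_0: "diffeo_rep f \<Longrightarrow> f 0 = 0"
  by (auto simp: diffeo_rep_def)

lemma eventually_diffeo_rep:
  "diffeo_rep f \<Longrightarrow> \<forall>\<^sub>F x in nhds 0. P x \<Longrightarrow> \<forall>\<^sub>F x in nhds 0. P (f x)"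
  using eventually_nhds_0_compose diffeo_rep_smooth diffeo_rep_0 by blast

lemma diffeo_rep_inverse:
  assumes "diffeo_rep f"
  obtains g where "diffeo_rep g" "\<forall>\<^sub>F x in nhds 0. g (f x) = x" "\<forall>\<^sub>F x in nhds 0. f (g x) = x"
  using assms unfolding diffeo_rep_def by blast

lemma diffeo_repI:
  assumes "smooth_near_0 f" "smooth_near_0 g" "f 0 = 0"
    "\<forall>\<^sub>F x in nhds 0. g (f x) = x" "\<forall>\<^sub>F x in nhds 0. f (g x) = x"
  shows "diffeo_rep f"
  using assms eventually_nhds_x_imp_x[OF assms(4)] unfolding diffeo_rep_def by auto

lemma diffeo_rep_compose:
  assumes "diffeo_rep f" "diffeo_rep g"
  shows "diffeo_rep (\<lambda>x. f (g x))"
proof -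
  obtain f' where f': "diffeo_rep f'" "\<forall>\<^sub>F x in nhds 0. f' (f x) = x" "\<forall>\<^sub>F x in nhds 0. f (f' x) = x"
    using diffeo_rep_inverse[OF assms(1)] .
  obtain g' where g': "diffeo_rep g'" "\<forall>\<^sub>F x in nhds 0. g' (g x) = x" "\<forall>\<^sub>F x in nhds 0. g (g' x) = x"
    using diffeo_rep_inverse[OF assms(2)] .
  show ?thesis
  proof (rule diffeo_repI[of _ "\<lambda>x. g' (f' x)"])
    show "smooth_near_0 (\<lambda>x. f (g x))"
      by (rule smooth_near_0_compose) (use assms in \<open>simp_all add: diffeo_rep_smooth diffeo_rep_0\<close>)
    show "smooth_near_0 (\<lambda>x. g' (f' x))"
      by (rule smooth_near_0_compose) (use f' g' in \<open>simp_all add: diffeo_rep_smooth diffeo_rep_0\<close>)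
    show "f (g 0) = 0" using assms by (simp add: diffeo_rep_0)
    show "\<forall>\<^sub>F x in nhds 0. g' (f' (f (g x))) = x"
      using g'(2) eventually_diffeo_rep[OF assms(2) f'(2)] by eventually_elim simp
    show "\<forall>\<^sub>F x in nhds 0. f (g (g' (f' x))) = x"
      using f'(3) eventually_diffeo_rep[OF f'(1) g'(3)] by eventually_elim simp
  qed
qed

lemma diffeo_rep_linear:
  fixes l :: "r4 \<Rightarrow> r4"
  assumes "linear l" "inj l"
  shows "diffeo_rep l"
proof -
  obtain m where "linear m" "\<And>x. m (l x) = x" "\<And>x. l (m x) = x"
    using linear_injective_isomorphism[OF assms] by blast
  then show ?thesis
    using assms by (intro diffeo_repI[of l m]) (auto intro: smooth_near_0_linear simp: linear_0)
qed

lemma D_left_inverse: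
  assumes "smooth_near_0 f" "f 0 = 0" "smooth_near_0 g" "\<forall>\<^sub>F x in nhds 0. g (f x) = x"
  shows "\<forall>\<^sub>F x in nhds 0. \<forall>v. D g (f x) (D f x v) = v"
  using D_chain[OF assms(3,1,2)] D_cong[OF assms(4)]
  by eventually_elim (metis frechet_derivative_ident)

lemma diffeo_rep_inj_D:
  assumes "diffeo_rep f"
  shows "\<forall>\<^sub>F x in nhds 0. inj (D f x)"
proof -
  obtain g where g: "diffeo_rep g" "\<forall>\<^sub>F x in nhds 0. g (f x) = x"
    using diffeo_rep_inverse[OF assms] by blast
  show ?thesis
    using D_left_inverse[OF diffeo_rep_smooth[OF assms] diffeo_rep_0[OF assms] diffeo_rep_smooth[OF g(1)] g(2)]
    by (rule eventually_mono) (metis injI)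
qed

lemma diffeo_rep_inj_D_0: "diffeo_rep f \<Longrightarrow> inj (D f 0)"
  using eventually_nhds_x_imp_x[OF diffeo_rep_inj_D] .

text \<open>
  The inverse function theorem yields a differentiable local inverse, and the bootstrap above makes
  it smooth.
\<close>

lemma diffeo_rep_if_inj_D:
  assumes f: "smooth_near_0 f" "f 0 = 0" and inj: "inj (D f 0)"
  shows "diffeo_rep f"
proof -
  obtain U where U: "open U" "0 \<in> U" "\<And>k. Ck_on k f U"
    using f unfolding smooth_near_0_def by blast
  have der: "(f has_derivative D f x) (at x)" if "x \<in> U" for x
    by (rule Ck_on_SucD[OF U(3) that])
  define f' where "f' x = Blinfun (D f x)" for x
  have f': "blinfun_apply (f' x) = D f x" if "x \<in> U" for x
    unfolding f'_def using bounded_linear_Blinfun_apply has_derivative_bounded_linear[OF der[OF that]] by blast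
  have cont: "continuous_on U f'"
  proof (rule continuous_on_blinfun_componentwise)
    fix i
    have "continuous_on U (\<lambda>x. D f x i)" using U(3)[of "Suc 0"] by simp
    then show "continuous_on U (\<lambda>x. f' x i)" by (simp add: f' cong: continuous_on_cong)
  qed
  obtain m where m: "linear m" "\<And>x. m (D f 0 x) = x"
    using linear_injective_isomorphism[OF smooth_near_0_linear_D[OF f(1)] inj] by blast
  then have bm: "blinfun_apply (Blinfun m) = m"
    by (simp add: bounded_linear_Blinfun_apply linear_conv_bounded_linear)
  have inv: "Blinfun m o\<^sub>L f' 0 = id_blinfun"
    by (rule blinfun_eqI) (simp add: bm f' U m)
  obtain U' V g g' where g: "open U'" "U' \<subseteq> U" "0 \<in> U'" "open V" "f 0 \<in> V" "homeomorphism U' V f g"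
    "\<And>y. y \<in> V \<Longrightarrow> (g has_derivative (g' y)) (at y)"
    "\<And>y. y \<in> V \<Longrightarrow> g' y = inv_into UNIV (blinfun_apply (f'(g y)))"
    "\<And>y. y \<in> V \<Longrightarrow> bij (blinfun_apply (f'(g y)))"
    using inverse_function_theorem[OF U(1) _ cont U(2) inv, of f] der f' by metis
  have gV: "g ` V \<subseteq> U" using g(2,6) by (auto simp: homeomorphism_def)
  then have gU: "y \<in> V \<Longrightarrow> g y \<in> U" for y by auto
  have "Ck_on k g V" for k
  proof (rule Ck_on_local_inverse[OF U(1) g(4) gV U(3) g(7)])
    show bij: "bij (D f (g y))" if "y \<in> V" for y
      using g(9)[OF that] f'[OF gU[OF that]] by simp
    show "D f (g y) (g' y v) = v" if "y \<in> V" for y v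
      using bij[OF that] g(8)[OF that] f'[OF gU[OF that]] by (simp add: bij_is_surj surj_f_inv_f)
    show "continuous_on V g" using g(6) by (simp add: homeomorphism_def)
  qed
  then have "smooth_near_0 g" unfolding smooth_near_0_def using g(4,5) f(2) by auto
  then show ?thesis
  proof (rule diffeo_repI[OF f(1) _ f(2)])
    show "\<forall>\<^sub>F x in nhds 0. g (f x) = x"
      unfolding eventually_nhds using g(1,3,6) by (auto simp: homeomorphism_def)
    show "\<forall>\<^sub>F x in nhds 0. f (g x) = x"
      unfolding eventually_nhds using g(4,5,6) f(2) by (auto simp: homeomorphism_def)
  qed
qed

section \<open>Groups generated by two involutions\<close>

context group
begin

context
  fixes a b w
  assumes a: "a \<in> carrier G" "a \<otimes> a = \<one>" and b: "b \<in> carrier G" "b \<otimes> b = \<one>"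
  defines "w \<equiv> a \<otimes> b"
begin

text \<open>
  Every element of the group generated by \<open>a\<close> and \<open>b\<close> is a power of \<open>w\<close>, possibly followed by \<open>a\<close>.
  The pairs are those of \<^const>\<open>dihedral_group\<close>, except that the exponent is an arbitrary integer.
\<close>

definition dihedral_word :: "int \<times> bool \<Rightarrow> 'a"
  where "dihedral_word = (\<lambda>(i, s). w [^] i \<otimes> (if s then a else \<one>))"

lemma product_closed: "w \<in> carrier G"
  using a b by (simp add: w_def)

lemma inv_involutions: "inv a = a" "inv b = b"
  using a b inv_equality by auto

text \<open>
  Conjugation by \<open>a\<close> maps \<open>w = a b\<close> to \<open>b a\<close>, its inverse.
\<close>

lemma involution_inverts_product: "a \<otimes> w [^] (k::int) = w [^] (- k) \<otimes> a"
proof -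
  have aw: "a \<otimes> w = inv w \<otimes> a"
    using a b by (simp add: w_def inv_mult_group inv_involutions m_assoc[symmetric])
      (simp add: m_assoc)
  have aw': "a \<otimes> inv w = w \<otimes> a"
    using a b by (simp add: w_def inv_mult_group inv_involutions m_assoc)
  note cl = a(1) product_closed
  show ?thesis
  proof (induction k rule: int_induct[where k = 0])
    case base then show ?case using a by simp
  next
    case (step1 i)
    have "a \<otimes> w [^] (i + 1) = (a \<otimes> w [^] i) \<otimes> w"
      using cl by (simp add: int_pow_mult m_assoc)
    also have "\<dots> = w [^] (- i) \<otimes> (a \<otimes> w)"
      using cl by (simp add: step1 m_assoc)
    also have "\<dots> = w [^] (- i + - 1) \<otimes> a"
      unfolding aw using cl
      by (simp only: int_pow_mult int_pow_neg int_pow_1 m_assoc int_pow_closed inv_closed)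
    finally show ?case by simp
  next
    case (step2 i)
    have "a \<otimes> w [^] (i + - 1) = (a \<otimes> w [^] i) \<otimes> inv w"
      using cl by (simp only: int_pow_mult m_assoc int_pow_neg int_pow_1 int_pow_closed inv_closed)
    also have "\<dots> = w [^] (- i) \<otimes> (a \<otimes> inv w)"
      using cl by (simp add: step2 m_assoc)
    also have "\<dots> = w [^] (- i + 1) \<otimes> a"
      unfolding aw' using cl by (simp only: int_pow_mult int_pow_1 m_assoc int_pow_closed)
    finally show ?case by simp
  qed
qed

lemma dihedral_word_mult:
  "dihedral_word (i, s) \<otimes> dihedral_word (j, t) = dihedral_word (if s then i - j else i + j, s \<noteq> t)"
proof -
  note cl = a(1) product_closed
  have *: "w [^] i \<otimes> a \<otimes> (w [^] j \<otimes> x) = w [^] (i - j) \<otimes> (a \<otimes> x)" if "x \<in> carrier G" for x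
  proof -
    have "w [^] i \<otimes> a \<otimes> (w [^] j \<otimes> x) = w [^] i \<otimes> (a \<otimes> w [^] j) \<otimes> x"
      using cl that by (simp add: m_assoc)
    also have "\<dots> = w [^] (i + - j) \<otimes> (a \<otimes> x)"
      unfolding involution_inverts_product using cl that by (simp only: int_pow_mult m_assoc int_pow_closed m_closed)
    finally show ?thesis by simp
  qed
  show ?thesis
    using cl *[of \<one>] *[OF a(1)]
    by (auto simp: dihedral_word_def int_pow_mult m_assoc a(2))
qed

lemma generate_eq_dihedral_words: "generate G {a, b} = range dihedral_word"
proof
  have w1: "dihedral_word (0, False) = \<one>" and wa: "dihedral_word (0, True) = a"
    using a by (auto simp: dihedral_word_def)
  have "dihedral_word (0, True) \<otimes> dihedral_word (1, False) = b"
    using a b by (simp add: dihedral_word_def w_def m_assoc[symmetric])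
  then have wb: "dihedral_word (- 1, True) = b"
    by (simp add: dihedral_word_mult)
  show "generate G {a, b} \<subseteq> range dihedral_word"
  proof
    fix x assume "x \<in> generate G {a, b}"
    then show "x \<in> range dihedral_word"
    proof induction
      case one
      then show ?case using w1 by (metis rangeI)
    next
      case (incl x)
      then show ?case using wa wb by (metis insertE rangeI singletonD)
    next
      case (inv x)
      then show ?case using wa wb inv_involutions by (metis insertE rangeI singletonD)
    next
      case (eng x y)
      then obtain i s j t where "x = dihedral_word (i, s)" "y = dihedral_word (j, t)" by auto
      then show ?case using dihedral_word_mult by simp
    qed
  qed
  have gens: "a \<in> generate G {a, b}" "b \<in> generate G {a, b}"
    by (auto intro: generate.incl)
  have "w [^] k \<in> generate G {a, b}" for k :: int
    using subgroup_int_pow_closed[OF generate_is_subgroup] gens a b generate.eng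
    unfolding w_def by (metis empty_subsetI insert_subset)
  then show "range dihedral_word \<subseteq> generate G {a, b}"
    using generate.eng[OF _ gens(1)] generate.eng[OF _ generate.one, of _ G "{a, b}"]
    by (auto simp: dihedral_word_def)
qed

lemma pow_eq_iff: "w [^] (i::int) = w [^] j \<longleftrightarrow> int (ord w) dvd i - j"
  using int_pow_eq[OF product_closed, of i j] by (simp add: dvd_diff_commute)

lemma pow_mod: "w [^] (i mod int (ord w)) = w [^] i"
  by (simp add: pow_eq_iff flip: mod_eq_dvd_iff)

lemma dihedral_words_mod:
  assumes "ord w > 0"
  shows "range dihedral_word = dihedral_word ` ({0..<int (ord w)} \<times> UNIV)"
proof -
  have "dihedral_word (i, s) \<in> dihedral_word ` ({0..<int (ord w)} \<times> UNIV)" for i s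
    by (rule image_eqI[of _ _ "(i mod int (ord w), s)"]) (use assms in \<open>simp_all add: dihedral_word_def pow_mod\<close>)
  then show ?thesis by auto
qed

lemma inj_on_dihedral_word:
  assumes "a \<notin> range (\<lambda>i::int. w [^] i)"
  shows "inj_on dihedral_word ({0..<int (ord w)} \<times> UNIV)"
proof (rule inj_onI, clarsimp)
  note cl = a(1) product_closed
  fix i s j t
  assume ij: "0 \<le> i" "i < int (ord w)" "0 \<le> j" "j < int (ord w)"
    and eq: "dihedral_word (i, s) = dihedral_word (j, t)"
  have no: False if "w [^] i \<otimes> a = w [^] j" for i j :: int
  proof -
    have "a = inv (w [^] i) \<otimes> w [^] j"
      using that cl inv_solve_left by (metis int_pow_closed)
    also have "\<dots> = w [^] (- i + j)"
      using cl by (simp only: int_pow_mult int_pow_neg)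
    finally show False using assms by blast
  qed
  have "s = t"
    using eq no[of i j] no[of j i] cl by (cases s; cases t) (auto simp: dihedral_word_def)
  moreover from this have "w [^] i = w [^] j"
    using eq cl by (auto simp: dihedral_word_def split: if_splits)
  then have "int (ord w) dvd i - j" by (simp add: pow_eq_iff)
  then have "i = j"
    using ij by (metis mod_eq_dvd_iff mod_pos_pos_trivial)
  ultimately show "i = j \<and> s = t" by simp
qed

text \<open>
  If \<open>a\<close> is a power of \<open>w\<close>, then it commutes with \<open>w\<close> while inverting it, so \<open>w\<close> is its own inverse.
\<close>

lemma involution_in_cyclic:
  assumes "a \<in> range (\<lambda>i::int. w [^] i)"
  shows "ord w dvd 2"
proof -
  note cl = a(1) product_closed
  obtain i :: int where "a = w [^] i" using assms by blast
  then have "w \<otimes> a = a \<otimes> w"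
    using cl int_pow_mult[of w 1 i] int_pow_mult[of w i 1] by (simp add: add.commute)
  also have "\<dots> = inv w \<otimes> a"
    using involution_inverts_product[of 1] cl by (simp add: int_pow_neg)
  finally have "w = inv w" using cl by simp
  then have "w [^] (2::nat) = \<one>"
    using cl by (metis nat_pow_0 nat_pow_Suc numeral_2_eq_2 l_one r_inv)
  then show ?thesis using pow_eq_id product_closed by blast
qed

text \<open>
  Only the cardinality of a dihedral group is needed to recover \<open>n\<close>. If \<open>a\<close> is not a power of \<open>w\<close>,
  the words are distinct up to the period of \<open>w\<close> and their number is twice that period. Otherwise the
  group consists of powers of \<open>w\<close>, of which there are at most two, fewer than \<open>2 * n\<close>.
\<close>

lemma ord_product_of_involutions:
  assumes card: "card (generate G {a, b}) = 2 * n" and n: "n \<ge> 2"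
  shows "ord w = n"
proof -
  let ?H = "generate G {a, b}"
  have fin: "finite ?H" using card n by (intro card_ge_0_finite) simp
  \<comment> \<open>An element of infinite order has \<open>ord\<close> equal to 0.\<close>
  have pos: "ord w > 0"
  proof (rule ccontr)
    assume "\<not> ord w > 0"
    then have "inj (\<lambda>i::int. w [^] i)"
      by (auto simp: inj_on_def pow_eq_iff)
    moreover have "range (\<lambda>i::int. w [^] i) \<subseteq> ?H"
    proof (rule image_subsetI)
      fix i :: int
      have "dihedral_word (i, False) \<in> ?H" by (simp add: generate_eq_dihedral_words)
      then show "w [^] i \<in> ?H" using product_closed by (simp add: dihedral_word_def)
    qed
    ultimately show False
      using fin finite_imageD finite_subset infinite_UNIV_int by blast
  qed
  have H: "?H = dihedral_word ` ({0..<int (ord w)} \<times> UNIV)"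
    by (simp add: generate_eq_dihedral_words dihedral_words_mod[OF pos])
  show ?thesis
  proof (cases "a \<in> range (\<lambda>i::int. w [^] i)")
    case False
    then have "card ?H = ord w * 2"
      unfolding H by (subst card_image[OF inj_on_dihedral_word]) (simp_all add: card_cartesian_product)
    then show ?thesis using card by simp
  next
    case True
    then obtain k :: int where k: "a = w [^] k" by blast
    have "?H \<subseteq> (\<lambda>i. w [^] i) ` {0..<int (ord w)}"
    proof -
      have "dihedral_word (i, s) = w [^] ((i + (if s then k else 0)) mod int (ord w))" for i s
      proof -
        have "dihedral_word (i, s) = w [^] (i + (if s then k else 0))"
          using product_closed by (simp add: dihedral_word_def int_pow_mult flip: k)
        then show ?thesis by (simp add: pow_mod)
      qed
      then show ?thesis using pos by (auto simp: generate_eq_dihedral_words)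
    qed
    then have "card ?H \<le> card {0..<int (ord w)}"
      by (rule surj_card_le[rotated]) simp
    moreover have "ord w \<le> 2" using involution_in_cyclic[OF True] by (auto dest: dvd_imp_le)
    ultimately show ?thesis using card n by simp
  qed
qed

text \<open>
  Reading pairs as words respects multiplication, so it suffices that distinct reduced words are
  distinct elements. For \<open>n > 2\<close> this follows since \<open>a\<close> inverts \<open>w\<close>; for \<open>n = 2\<close> the involution \<open>a\<close> could
  still be a power of \<open>w\<close>, but then \<open>a\<close> or \<open>b\<close> would be trivial.
\<close>

lemma generated_by_involutions_iso_dihedral:
  assumes ord: "ord w = n" "n \<ge> 2" and ne: "a \<noteq> \<one>" "b \<noteq> \<one>"
  shows "subgroup_generated G {a, b} \<cong> dihedral_group n"
proof -
  note cl = a(1) product_closed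
  let ?S = "subgroup_generated G {a, b}" and ?C = "{0..<int n} \<times> (UNIV :: bool set)"
  have notin: "a \<notin> range (\<lambda>i::int. w [^] i)"
  proof
    assume A: "a \<in> range (\<lambda>i::int. w [^] i)"
    then obtain k :: int where k: "a = w [^] k" by blast
    have "n = 2" using involution_in_cyclic[OF A] ord by (auto dest: dvd_imp_le)
    then have "a = w [^] (k mod 2)" using k ord pow_mod[of k] by simp
    moreover have "k mod 2 = 0 \<or> k mod 2 = 1" by linarith
    ultimately have "a = \<one> \<or> a = w" using cl by auto
    then have "a = a \<otimes> b" using ne by (simp add: w_def)
    then show False using a b ne by (metis l_cancel_one' r_cancel_one' l_cancel_one)
  qed
  have C: "carrier ?S = range dihedral_word"
    using a b by (simp add: carrier_subgroup_generated generate_eq_dihedral_words)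
  have bij: "bij_betw dihedral_word ?C (carrier ?S)"
    using inj_on_dihedral_word[OF notin] dihedral_words_mod ord by (simp add: C bij_betw_def)
  have mult: "dihedral_word (p \<otimes>\<^bsub>dihedral_group n\<^esub> q) = dihedral_word p \<otimes> dihedral_word q" for p q
  proof (cases p; cases q)
    fix i s j t assume "p = (i, s)" "q = (j, t)"
    moreover have "dihedral_word (k mod int n, u) = dihedral_word (k, u)" for k u
      using pow_mod[of k] ord by (simp add: dihedral_word_def)
    ultimately show ?thesis by (simp add: dihedral_group_def dihedral_word_mult)
  qed
  let ?g = "inv_into ?C dihedral_word"
  have "?g \<in> iso ?S (dihedral_group n)"
  proof (rule isoI)
    show "bij_betw ?g (carrier ?S) (carrier (dihedral_group n))"
      using bij_betw_inv_into[OF bij] by (simp add: dihedral_group_def)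
    show "?g \<in> hom ?S (dihedral_group n)"
    proof (rule homI)
      show "?g x \<in> carrier (dihedral_group n)" if "x \<in> carrier ?S" for x
        using bij_betw_inv_into[OF bij] that by (auto simp: dihedral_group_def bij_betw_def)
      fix x y assume xy: "x \<in> carrier ?S" "y \<in> carrier ?S"
      then have "?g x \<in> ?C" "?g y \<in> ?C" "dihedral_word (?g x) = x" "dihedral_word (?g y) = y"
        using bij by (auto simp: bij_betw_def inv_into_into f_inv_into_f)
      moreover from this have "?g x \<otimes>\<^bsub>dihedral_group n\<^esub> ?g y \<in> ?C"
        using ord by (auto simp: dihedral_group_def split: prod.splits)
      moreover have "x \<otimes>\<^bsub>?S\<^esub> y = dihedral_word (?g x \<otimes>\<^bsub>dihedral_group n\<^esub> ?g y)"
        using calculation by (simp only: mult mult_subgroup_generated)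
      ultimately show "?g (x \<otimes>\<^bsub>?S\<^esub> y) = ?g x \<otimes>\<^bsub>dihedral_group n\<^esub> ?g y"
        using bij_betw_inv_into_left[OF bij] by metis
    qed
  qed
  then show ?thesis by (rule is_isoI)
qed

end

end

section \<open>The group of diffeomorphism germs\<close>

lemma germ_eq_iff: "germ f = germ g \<longleftrightarrow> (\<forall>\<^sub>F x in nhds 0. f x = g x)"
proof
  assume "germ f = germ g"
  then have "f \<in> germ g" by (auto simp: germ_def)
  then show "\<forall>\<^sub>F x in nhds 0. f x = g x" by (simp add: germ_def)
next
  assume eq: "\<forall>\<^sub>F x in nhds 0. f x = g x"
  have "(\<forall>\<^sub>F x in nhds 0. u x = f x) \<longleftrightarrow> (\<forall>\<^sub>F x in nhds 0. u x = g x)" for u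
    by (rule eventually_cong[OF eq]) auto
  then show "germ f = germ g" by (simp add: germ_def)
qed

lemma carrier_diffeo_group: "carrier diffeo_group = germ ` {f. diffeo_rep f}"
  by (simp add: diffeo_group_def)

lemma one_diffeo_group: "\<one>\<^bsub>diffeo_group\<^esub> = germ (\<lambda>x. x)"
  by (simp add: diffeo_group_def id_def)

lemma mult_diffeo_group:
  assumes "diffeo_rep f" "diffeo_rep g"
  shows "germ f \<otimes>\<^bsub>diffeo_group\<^esub> germ g = germ (\<lambda>x. f (g x))"
proof -
  have "germ (f' \<circ> g') = germ (\<lambda>x. f (g x))" if "f' \<in> germ f" "g' \<in> germ g" for f' g'
  proof -
    have "\<forall>\<^sub>F x in nhds 0. g' x = g x" "\<forall>\<^sub>F x in nhds 0. f' (g x) = f (g x)"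
      using that eventually_diffeo_rep[OF assms(2), of "\<lambda>x. f' x = f x"] by (simp_all add: germ_def)
    then have "\<forall>\<^sub>F x in nhds 0. (f' \<circ> g') x = f (g x)" by eventually_elim simp
    then show ?thesis by (simp add: germ_eq_iff)
  qed
  moreover have "f \<in> germ f" "g \<in> germ g" by (auto simp: germ_def)
  ultimately show ?thesis by (auto simp: diffeo_group_def)
qed

lemma diffeo_rep_id: "diffeo_rep (\<lambda>x. x)"
  using diffeo_rep_linear[OF linear_id] by (simp add: id_def)

lemma group_diffeo_group: "group diffeo_group"
proof (rule groupI)
  fix F assume "F \<in> carrier diffeo_group"
  then obtain f where f: "F = germ f" "diffeo_rep f" by (auto simp: carrier_diffeo_group)
  then obtain g where g: "diffeo_rep g" "\<forall>\<^sub>F x in nhds 0. g (f x) = x"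
    using diffeo_rep_inverse[OF f(2)] by blast
  then have "germ g \<otimes>\<^bsub>diffeo_group\<^esub> F = \<one>\<^bsub>diffeo_group\<^esub>"
    by (simp add: f mult_diffeo_group one_diffeo_group germ_eq_iff)
  then show "\<exists>G\<in>carrier diffeo_group. G \<otimes>\<^bsub>diffeo_group\<^esub> F = \<one>\<^bsub>diffeo_group\<^esub>"
    using g by (auto simp: carrier_diffeo_group)
qed (auto simp: carrier_diffeo_group one_diffeo_group mult_diffeo_group diffeo_rep_compose diffeo_rep_id)

interpretation diffeo: group diffeo_group
  by (rule group_diffeo_group)

lemma diffeo_rep_funpow: "diffeo_rep f \<Longrightarrow> diffeo_rep (f ^^ n)"
proof (induction n)
  case 0 then show ?case using diffeo_rep_id by (simp add: id_def)
next
  case (Suc n)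
  then show ?case using diffeo_rep_compose[of f "f ^^ n"] by (simp add: o_def)
qed

lemma pow_diffeo_group:
  assumes "diffeo_rep f"
  shows "germ f [^]\<^bsub>diffeo_group\<^esub> n = germ (f ^^ n)"
proof (induction n)
  case 0 then show ?case by (simp add: one_diffeo_group id_def)
next
  case (Suc n)
  then show ?case
    using mult_diffeo_group[OF diffeo_rep_funpow[OF assms] assms, of n]
    by (simp add: funpow_Suc_right o_def del: funpow.simps)
qed

lemma (in group) ord_eq_iff:
  assumes "x \<in> carrier G" "n > 0"
  shows "ord x = n \<longleftrightarrow> x [^] n = \<one> \<and> (\<forall>k. 0 < k \<and> k < n \<longrightarrow> x [^] k \<noteq> \<one>)"
proof
  assume "ord x = n"
  then show "x [^] n = \<one> \<and> (\<forall>k. 0 < k \<and> k < n \<longrightarrow> x [^] k \<noteq> \<one>)"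
    using assms pow_eq_id by (auto dest: dvd_imp_le)
next
  assume *: "x [^] n = \<one> \<and> (\<forall>k. 0 < k \<and> k < n \<longrightarrow> x [^] k \<noteq> \<one>)"
  then have "ord x dvd n" using assms pow_eq_id by blast
  then have "ord x \<le> n" "0 < ord x" using assms by (auto dest: dvd_imp_le intro: dvd_pos_nat)
  moreover have "x [^] ord x = \<one>" using assms by simp
  ultimately show "ord x = n" using * by (meson le_neq_implies_less)
qed

text \<open>
  The isomorphism type of the generated group enters the rest of the argument only through this
  criterion: \<open>n\<close> is the period of the germ of \<open>\<phi> \<circ> \<psi>\<close>.
\<close>

lemma generated_iso_dihedral_iff_order:
  assumes "involution_rep \<phi>" "involution_rep \<psi>" "n \<ge> 2"
    and "\<not> (\<forall>\<^sub>F x in nhds 0. \<phi> x = x)" "\<not> (\<forall>\<^sub>F x in nhds 0. \<psi> x = x)"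
  defines "w \<equiv> \<lambda>x. \<phi> (\<psi> x)"
  shows "subgroup_generated diffeo_group {germ \<phi>, germ \<psi>} \<cong> dihedral_group n \<longleftrightarrow>
    (\<forall>\<^sub>F x in nhds 0. (w ^^ n) x = x) \<and> (\<forall>k. 0 < k \<and> k < n \<longrightarrow> \<not> (\<forall>\<^sub>F x in nhds 0. (w ^^ k) x = x))"
    (is "?L \<longleftrightarrow> ?R")
proof -
  have d: "diffeo_rep \<phi>" "diffeo_rep \<psi>" "diffeo_rep w"
    using assms(1,2) diffeo_rep_compose by (auto simp: involution_rep_def w_def)
  have c: "germ \<phi> \<in> carrier diffeo_group" "germ \<psi> \<in> carrier diffeo_group" "germ w \<in> carrier diffeo_group"
    using d by (auto simp: carrier_diffeo_group)
  have i: "germ \<phi> \<otimes>\<^bsub>diffeo_group\<^esub> germ \<phi> = \<one>\<^bsub>diffeo_group\<^esub>"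
    "germ \<psi> \<otimes>\<^bsub>diffeo_group\<^esub> germ \<psi> = \<one>\<^bsub>diffeo_group\<^esub>"
    using assms(1,2) d by (simp_all add: mult_diffeo_group one_diffeo_group germ_eq_iff involution_rep_def)
  have w: "germ \<phi> \<otimes>\<^bsub>diffeo_group\<^esub> germ \<psi> = germ w"
    using d by (simp add: mult_diffeo_group w_def)
  have pow: "germ w [^]\<^bsub>diffeo_group\<^esub> k = \<one>\<^bsub>diffeo_group\<^esub> \<longleftrightarrow> (\<forall>\<^sub>F x in nhds 0. (w ^^ k) x = x)" for k :: nat
    by (simp add: pow_diffeo_group d one_diffeo_group germ_eq_iff)
  have "?R \<longleftrightarrow> group.ord diffeo_group (germ w) = n"
    using assms(3) diffeo.ord_eq_iff[OF c(3), of n] by (simp add: pow)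
  also have "\<dots> \<longleftrightarrow> ?L"
  proof
    assume "group.ord diffeo_group (germ w) = n"
    then show ?L
      using diffeo.generated_by_involutions_iso_dihedral[OF c(1) i(1) c(2) i(2)] assms(3-5)
      by (simp add: w one_diffeo_group germ_eq_iff)
  next
    assume ?L
    then have "card (generate diffeo_group {germ \<phi>, germ \<psi>}) = card (carrier (dihedral_group n))"
      using iso_same_card c by (fastforce simp: carrier_subgroup_generated)
    then have "card (generate diffeo_group {germ \<phi>, germ \<psi>}) = 2 * n"
      by (simp add: dihedral_group_def card_cartesian_product)
    then show "group.ord diffeo_group (germ w) = n"
      using diffeo.ord_product_of_involutions[OF c(1) i(1) c(2) i(2)] assms(3) by (simp add: w)
  qed
  finally show ?thesis by blast
qed

section \<open>Linearisation by averaging\<close>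

lemma linear_funpow: "linear f \<Longrightarrow> linear (f ^^ n)" for f :: "r4 \<Rightarrow> r4"
  by (induction n) (auto intro: linear_compose simp: linear_id id_def[symmetric])

lemma D_funpow_0:
  assumes "diffeo_rep f"
  shows "D (f ^^ n) 0 = D f 0 ^^ n"
proof (induction n)
  case 0 then show ?case by (simp add: id_def)
next
  case (Suc n)
  have "D (f ^^ Suc n) 0 = D (\<lambda>x. f ((f ^^ n) x)) 0" by (simp add: o_def)
  also have "\<dots> = (\<lambda>v. D f 0 (D (f ^^ n) 0 v))"
    using D_chain_0[of f "f ^^ n"] assms diffeo_rep_funpow[OF assms, of n]
    by (auto simp: diffeo_rep_smooth diffeo_rep_0)
  finally show ?case by (simp add: Suc o_def)
qed

text \<open>
  With \<open>W\<close> the derivative of \<open>w\<close> at the origin, \<open>h\<close> is the average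
  of the maps \<open>W^(-i) \<circ> w^i\<close>, up to a factor \<open>n\<close>; since \<open>W^n = 1\<close> the inverse power can be
  written \<open>W^(n - i)\<close>. Each summand has the identity as derivative at the origin, and precomposition
  with \<open>w\<close> permutes the summands up to a factor \<open>W\<close>.
\<close>

lemma average_cyclic:
  assumes w: "diffeo_rep w" "\<forall>\<^sub>F x in nhds 0. (w ^^ n) x = x"
  obtains h where "smooth_near_0 h" "h 0 = 0" "D h 0 = (\<lambda>v. real n *\<^sub>R v)"
    "\<forall>\<^sub>F x in nhds 0. h (w x) = D w 0 (h x)"
proof -
  define W where "W = D w 0"
  have lin: "linear (W ^^ i)" for i
    unfolding W_def by (intro linear_funpow smooth_near_0_linear_D diffeo_rep_smooth w)
  have Wn: "W ^^ n = id"
    using D_cong_0[OF w(2)] D_funpow_0[OF w(1), of n] by (simp add: W_def id_def)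
  define h where "h x = (\<Sum>i<n. (W ^^ (n - i)) ((w ^^ i) x))" for x
  note wi = diffeo_rep_funpow[OF w(1)]
  have "smooth_near_0 h"
    unfolding h_def
    by (intro smooth_near_0_sum smooth_near_0_compose[OF smooth_near_0_linear[OF lin]]
      diffeo_rep_smooth[OF wi] diffeo_rep_0[OF wi])
  moreover have "h 0 = 0"
    by (simp add: h_def diffeo_rep_0[OF wi] linear_0[OF lin])
  moreover have "D h 0 = (\<lambda>v. real n *\<^sub>R v)"
  proof -
    have "(w ^^ i has_derivative W ^^ i) (at 0)" for i
      using smooth_near_0_has_derivative_0[OF diffeo_rep_smooth[OF wi]] D_funpow_0[OF w(1)]
      by (simp add: W_def)
    then have "((\<lambda>x. (W ^^ (n - i)) ((w ^^ i) x)) has_derivative (\<lambda>v. (W ^^ (n - i)) ((W ^^ i) v))) (at 0)" for i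
      using bounded_linear.has_derivative lin linear_conv_bounded_linear by blast
    then have "(h has_derivative (\<lambda>v. \<Sum>i<n. (W ^^ (n - i)) ((W ^^ i) v))) (at 0)"
      unfolding h_def by (rule has_derivative_sum)
    moreover have "(W ^^ (n - i)) ((W ^^ i) v) = v" if "i < n" for i v
      using that Wn funpow_add[of "n - i" i W] by (metis comp_apply id_apply le_add_diff_inverse2 less_imp_le)
    ultimately have "(h has_derivative (\<lambda>v. \<Sum>i<n. v)) (at 0)"
      by (simp cong: sum.cong_simp)
    then have "(h has_derivative (\<lambda>v. real n *\<^sub>R v)) (at 0)"
      by (simp only: sum_constant_scaleR card_lessThan)
    from frechet_derivative_at[OF this, symmetric] show ?thesis .
  qed
  moreover have "\<forall>\<^sub>F x in nhds 0. h (w x) = D w 0 (h x)"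
    using w(2)
  proof eventually_elim
    case (elim x)
    define f where "f i = (W ^^ (Suc n - i)) ((w ^^ i) x)" for i
    have "h (w x) = (\<Sum>i<n. f (Suc i))"
      by (simp add: h_def f_def funpow_swap1)
    moreover have "W (h x) = (\<Sum>i<n. f i)"
      using lin[of 1] by (simp add: h_def f_def linear_sum Suc_diff_le)
    moreover have "(\<Sum>i<n. f (Suc i)) - (\<Sum>i<n. f i) = f n - f 0"
      using sum_lessThan_telescope[of f n] by (simp add: sum_subtractf)
    moreover have "f n = W x" "f 0 = W x"
      using elim Wn by (simp_all add: f_def)
    ultimately show ?case by (simp add: W_def)
  qed
  ultimately show thesis using that by blast
qed

text \<open>
  The average over the dihedral group, taken over the rotations first: if \<open>h1\<close> intertwines \<open>\<phi> \<circ> \<psi>\<close>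
  with its derivative \<open>P Q\<close>, then \<open>h1 + P \<circ> h1 \<circ> \<phi>\<close> intertwines both involutions. The derivative
  of the sum at the origin is \<open>2 n\<close> times the identity, so the sum is a diffeomorphism germ.
\<close>

lemma linearize_two_involutions:
  assumes \<phi>: "involution_rep \<phi>" and \<psi>: "involution_rep \<psi>" and "n > 0"
    and fin: "\<forall>\<^sub>F x in nhds 0. ((\<lambda>x. \<phi> (\<psi> x)) ^^ n) x = x"
  obtains h where "diffeo_rep h"
    "\<forall>\<^sub>F x in nhds 0. h (\<phi> x) = D \<phi> 0 (h x)" "\<forall>\<^sub>F x in nhds 0. h (\<psi> x) = D \<psi> 0 (h x)"
proof -
  have d: "diffeo_rep \<phi>" "diffeo_rep \<psi>"
    and inv: "\<forall>\<^sub>F x in nhds 0. \<phi> (\<phi> x) = x" "\<forall>\<^sub>F x in nhds 0. \<psi> (\<psi> x) = x"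
    using \<phi> \<psi> by (auto simp: involution_rep_def)
  note s = d[THEN diffeo_rep_smooth] and z = d[THEN diffeo_rep_0]
  define P where "P = D \<phi> 0"
  define Q where "Q = D \<psi> 0"
  have lP: "linear P" and lQ: "linear Q"
    unfolding P_def Q_def by (intro smooth_near_0_linear_D s)+
  have PP: "P (P v) = v" and QQ: "Q (Q v) = v" for v
    using D_cong_0[OF inv(1)] D_cong_0[OF inv(2)] D_chain_0[OF s(1) s(1) z(1), of v] D_chain_0[OF s(2) s(2) z(2), of v]
    by (simp_all add: P_def Q_def)
  obtain h1 where h1: "smooth_near_0 h1" "h1 0 = 0" "D h1 0 = (\<lambda>v. real n *\<^sub>R v)"
    and "\<forall>\<^sub>F x in nhds 0. h1 (\<phi> (\<psi> x)) = D (\<lambda>x. \<phi> (\<psi> x)) 0 (h1 x)"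
    using average_cyclic[OF diffeo_rep_compose[OF d] fin] by blast
  then have h1w: "\<forall>\<^sub>F x in nhds 0. h1 (\<phi> (\<psi> x)) = P (Q (h1 x))"
    by (simp add: D_chain_0[OF s z(2)] P_def Q_def)
  define h where "h x = h1 x + P (h1 (\<phi> x))" for x
  have sm: "smooth_near_0 (\<lambda>x. P (h1 (\<phi> x)))" "smooth_near_0 (\<lambda>x. h1 (\<phi> x))"
    using smooth_near_0_compose[OF h1(1) s(1) z(1)] smooth_near_0_compose[OF smooth_near_0_linear[OF lP]]
    by (auto simp: z h1)
  have "diffeo_rep h"
  proof (rule diffeo_rep_if_inj_D)
    show "smooth_near_0 h" "h 0 = 0"
      using smooth_near_0_add[OF h1(1) sm(1)] by (simp_all add: h_def[abs_def] z h1 linear_0[OF lP])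
    have "D (\<lambda>x. P (h1 (\<phi> x))) 0 v = real n *\<^sub>R v" for v
      using D_chain_0[OF smooth_near_0_linear[OF lP] sm(2)] D_chain_0[OF h1(1) s(1) z(1)]
      by (simp add: z h1 D_linear[OF lP] linear_scale[OF lP] PP flip: P_def)
    then have "(h has_derivative (\<lambda>v. real n *\<^sub>R v + real n *\<^sub>R v)) (at 0)"
      unfolding h_def
      using has_derivative_add[OF smooth_near_0_has_derivative_0[OF h1(1)] smooth_near_0_has_derivative_0[OF sm(1)]]
      by (simp add: h1(3))
    from frechet_derivative_at[OF this, symmetric] show "inj (D h 0)"
      using \<open>n > 0\<close> by (auto intro!: injI simp flip: scaleR_2)
  qed
  moreover have "\<forall>\<^sub>F x in nhds 0. h (\<phi> x) = P (h x)"
    using inv(1) by eventually_elim (simp add: h_def linear_add[OF lP] PP)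
  moreover have "\<forall>\<^sub>F x in nhds 0. h (\<psi> x) = Q (h x)"
    using h1w eventually_diffeo_rep[OF d(2) h1w] inv(2)
  proof eventually_elim
    case (elim x)
    \<comment> \<open>The equation for \<open>h1\<close> at \<open>\<psi> x\<close>, where \<open>\<phi> (\<psi> (\<psi> x)) = \<phi> x\<close>, solved for \<open>h1 (\<psi> x)\<close>.\<close>
    have "h1 (\<psi> x) = Q (P (h1 (\<phi> x)))"
      using elim by (simp add: PP QQ)
    then show ?case
      using elim by (simp add: h_def linear_add[OF lQ] PP)
  qed
  ultimately show thesis using that by (simp add: P_def Q_def)
qed

section \<open>Reversibility and changes of coordinates\<close>

lemma smooth_near_0_D:
  assumes "smooth_near_0 f"
  shows "smooth_near_0 (\<lambda>x. D f x v)"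
proof -
  obtain U where U: "open U" "0 \<in> U" "\<And>k. Ck_on k f U"
    using assms unfolding smooth_near_0_def by blast
  have "Ck_on k (\<lambda>x. D f x v) U" for k
    using U(3)[of "Suc k"] by simp
  with U(1,2) show ?thesis unfolding smooth_near_0_def by blast
qed

text \<open>
  In the product rule the term with the second derivative of \<open>f\<close> disappears because \<open>X\<close> vanishes at
  the origin.
\<close>

lemma D_D_apply_0:
  assumes f: "smooth_near_0 f" and X: "smooth_near_0 X" "X 0 = 0"
  shows "D (\<lambda>x. D f x (X x)) 0 v = D f 0 (D X 0 v)"
proof -
  have expand: "l u = (\<Sum>b\<in>Basis. (u \<bullet> b) *\<^sub>R l b)" if "linear l" for l :: "r4 \<Rightarrow> r4" and u
    using linear_sum[OF that, of "\<lambda>b. (u \<bullet> b) *\<^sub>R b" Basis]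
    by (simp add: euclidean_representation linear_scale[OF that])
  have "\<forall>\<^sub>F x in nhds 0. D f x (X x) = (\<Sum>b\<in>Basis. (X x \<bullet> b) *\<^sub>R D f x b)"
    using smooth_near_0_has_derivative[OF f] by eventually_elim (rule expand[OF has_derivative_linear])
  then have "D (\<lambda>x. D f x (X x)) 0 = D (\<lambda>x. \<Sum>b\<in>Basis. (X x \<bullet> b) *\<^sub>R D f x b) 0"
    by (rule D_cong_0)
  also have "\<dots> = (\<lambda>v. \<Sum>b\<in>Basis. (X 0 \<bullet> b) *\<^sub>R D (\<lambda>x. D f x b) 0 v + (D X 0 v \<bullet> b) *\<^sub>R D f 0 b)"
  proof -
    have "((\<lambda>x. (X x \<bullet> b) *\<^sub>R D f x b) has_derivative
        (\<lambda>v. (X 0 \<bullet> b) *\<^sub>R D (\<lambda>x. D f x b) 0 v + (D X 0 v \<bullet> b) *\<^sub>R D f 0 b)) (at 0)" for b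
    proof (rule has_derivative_scaleR)
      show "((\<lambda>x. X x \<bullet> b) has_derivative (\<lambda>v. D X 0 v \<bullet> b)) (at 0)"
        by (rule has_derivative_inner_left[OF smooth_near_0_has_derivative_0[OF X(1)]])
      show "((\<lambda>x. D f x b) has_derivative D (\<lambda>x. D f x b) 0) (at 0)"
        by (rule smooth_near_0_has_derivative_0[OF smooth_near_0_D[OF f]])
    qed
    then have "((\<lambda>x. \<Sum>b\<in>Basis. (X x \<bullet> b) *\<^sub>R D f x b) has_derivative
        (\<lambda>v. \<Sum>b\<in>Basis. (X 0 \<bullet> b) *\<^sub>R D (\<lambda>x. D f x b) 0 v + (D X 0 v \<bullet> b) *\<^sub>R D f 0 b)) (at 0)"
      by (rule has_derivative_sum)
    from frechet_derivative_at[OF this, symmetric] show ?thesis .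
  qed
  finally have "D (\<lambda>x. D f x (X x)) 0 v = (\<Sum>b\<in>Basis. (D X 0 v \<bullet> b) *\<^sub>R D f 0 b)"
    by (simp add: X(2))
  also have "\<dots> = D f 0 (D X 0 v)"
    by (rule expand[OF smooth_near_0_linear_D[OF f], symmetric])
  finally show ?thesis .
qed

lemma reversible_D_0:
  assumes \<phi>: "smooth_near_0 \<phi>" "\<phi> 0 = 0" and X: "smooth_near_0 X" "X 0 = 0"
    and rev: "reversible \<phi> X"
  shows "D \<phi> 0 (D X 0 v) = - D X 0 (D \<phi> 0 v)"
proof -
  have lin: "linear (\<lambda>x::r4. - x)" by (intro linearI) auto
  have sm: "smooth_near_0 (\<lambda>x. X (\<phi> x))" by (rule smooth_near_0_compose[OF X(1) \<phi>])
  have "D \<phi> 0 (D X 0 v) = D (\<lambda>x. - X (\<phi> x)) 0 v"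
    using D_cong_0[OF rev[unfolded reversible_def]] D_D_apply_0[OF \<phi>(1) X] by simp
  also have "\<dots> = - D X 0 (D \<phi> 0 v)"
    using D_chain_0[OF smooth_near_0_linear[OF lin] sm] D_chain_0[OF X(1) \<phi>]
    by (simp add: X \<phi> D_linear[OF lin])
  finally show ?thesis .
qed

lemma linear_inj_imp_0:
  assumes "linear f" "inj f" "f x = 0" shows "x = 0"
  using injD[OF assms(2), of x 0] assms(3) linear_0[OF assms(1)] by simp

lemma linear_injI:
  assumes "linear f" "\<And>x. f x = 0 \<Longrightarrow> x = 0" shows "inj f"
  using assms(2) by (subst linear_injective_0[OF assms(1)]) blast

lemma eq_neg_imp_0: 
  fixes x :: "'a::real_vector"
  assumes "x = - x" shows "x = 0"
proof -
  have "2 *\<^sub>R x = 0" using assms by (simp add: scaleR_2 eq_neg_iff_add_eq_0)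
  then show ?thesis by simp
qed

text \<open>
  A field that is reversible under the identity equals its own negative, so the origin is not an
  isolated zero.
\<close>

lemma not_reversible_id:
  assumes X: "vector_field_rep X" and rev: "reversible \<phi> X"
  shows "\<not> (\<forall>\<^sub>F x in nhds 0. \<phi> x = x)"
proof
  assume id: "\<forall>\<^sub>F x in nhds 0. \<phi> x = x"
  have "\<forall>\<^sub>F x in nhds 0. X x = - X x"
    using rev[unfolded reversible_def] id D_cong[OF id] by eventually_elim simp
  then have "\<forall>\<^sub>F x in nhds 0. X x = 0"
    by (rule eventually_mono) (rule eq_neg_imp_0)
  then have "\<forall>\<^sub>F x in at 0. X x = 0"
    by (simp add: eventually_nhds_conv_at)
  moreover have "\<forall>\<^sub>F x in at 0. X x \<noteq> 0" using X by (simp add: vector_field_rep_def)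
  ultimately have "\<forall>\<^sub>F x in at (0::r4). False" by eventually_elim simp
  then show False by simp
qed

lemma vector_field_in_coordinates:
  assumes h: "diffeo_rep h" and X: "vector_field_rep X"
  obtains Y where "vector_field_rep Y" "in_coordinates h X Y"
proof -
  obtain g where g: "diffeo_rep g" "\<forall>\<^sub>F x in nhds 0. g (h x) = x" "\<forall>\<^sub>F x in nhds 0. h (g x) = x"
    using diffeo_rep_inverse[OF h] .
  have Xs: "smooth_near_0 X" "X 0 = 0" and X0: "\<forall>\<^sub>F x in nhds 0. x \<noteq> 0 \<longrightarrow> X x \<noteq> 0"
    using X by (auto simp: vector_field_rep_def eventually_at_filter)
  note hs = diffeo_rep_smooth[OF h] and gs = diffeo_rep_smooth[OF g(1)]
  have hl: "\<forall>\<^sub>F x in nhds 0. linear (D h x)"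
    using smooth_near_0_has_derivative[OF hs] by eventually_elim (rule has_derivative_linear)
  define Y where "Y y = D h (g y) (X (g y))" for y
  have "smooth_near_0 Y"
    using smooth_near_0_compose[OF smooth_near_0_D_apply[OF hs Xs(1)] gs diffeo_rep_0[OF g(1)]]
    by (simp add: Y_def[abs_def])
  moreover have "Y 0 = 0"
    by (simp add: Y_def diffeo_rep_0[OF g(1)] Xs linear_0[OF smooth_near_0_linear_D[OF hs]])
  moreover have "\<forall>\<^sub>F y in nhds 0. y \<noteq> 0 \<longrightarrow> Y y \<noteq> 0"
    using g(3) eventually_diffeo_rep[OF g(1) X0] eventually_diffeo_rep[OF g(1) hl]
      eventually_diffeo_rep[OF g(1) diffeo_rep_inj_D[OF h]]
  proof eventually_elim
    case (elim y)
    show ?case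
    proof (intro impI notI)
      assume "y \<noteq> 0" "Y y = 0"
      then have "X (g y) = 0"
        using linear_inj_imp_0[OF elim(3,4)] by (simp add: Y_def)
      then have "h 0 = y" using elim(1,2) by auto
      then show False using \<open>y \<noteq> 0\<close> diffeo_rep_0[OF h] by simp
    qed
  qed
  ultimately have "vector_field_rep Y" by (simp add: vector_field_rep_def eventually_at_filter)
  moreover have "in_coordinates h X Y"
    unfolding in_coordinates_def using g(2) by eventually_elim (simp add: Y_def)
  ultimately show thesis by (rule that)
qed

text \<open>
  After the coordinate change both sides of the reversibility equation of \<open>Y\<close> at \<open>h x\<close> are the images of
  those of \<open>X\<close> at \<open>x\<close> under the derivative of \<open>h\<close> at \<open>\<phi> x\<close>, which is injective.
\<close>

lemma reversible_in_coordinates: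
  assumes h: "diffeo_rep h" and XY: "in_coordinates h X Y"
    and \<phi>: "diffeo_rep \<phi>" and M: "linear M" and conj: "\<forall>\<^sub>F x in nhds 0. h (\<phi> x) = M (h x)"
  shows "reversible M Y \<longleftrightarrow> reversible \<phi> X"
proof -
  obtain g where g: "diffeo_rep g" "\<forall>\<^sub>F x in nhds 0. g (h x) = x" "\<forall>\<^sub>F x in nhds 0. h (g x) = x"
    using diffeo_rep_inverse[OF h] .
  note hs = diffeo_rep_smooth[OF h] and \<phi>s = diffeo_rep_smooth[OF \<phi>]
  have hl: "\<forall>\<^sub>F x in nhds 0. linear (D h x)"
    using smooth_near_0_has_derivative[OF hs] by eventually_elim (rule has_derivative_linear)
  have "reversible M Y \<longleftrightarrow> (\<forall>\<^sub>F y in nhds 0. M (Y y) = - Y (M y))"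
    by (simp add: reversible_def D_linear[OF M])
  also have "\<dots> \<longleftrightarrow> (\<forall>\<^sub>F x in nhds 0. M (Y (h x)) = - Y (M (h x)))"
  proof
    assume "\<forall>\<^sub>F x in nhds 0. M (Y (h x)) = - Y (M (h x))"
    from eventually_diffeo_rep[OF g(1) this] g(3)
    show "\<forall>\<^sub>F y in nhds 0. M (Y y) = - Y (M y)" by eventually_elim simp
  qed (rule eventually_diffeo_rep[OF h])
  also have "\<dots> \<longleftrightarrow> (\<forall>\<^sub>F x in nhds 0. D \<phi> x (X x) = - X (\<phi> x))"
  proof (rule eventually_cong)
    show "\<forall>\<^sub>F x in nhds 0. (M (Y (h x)) = - Y (M (h x))) = (D \<phi> x (X x) = - X (\<phi> x))"
      using XY[unfolded in_coordinates_def] eventually_diffeo_rep[OF \<phi> XY[unfolded in_coordinates_def]]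
        conj D_cong[OF conj] D_chain[OF hs \<phi>s diffeo_rep_0[OF \<phi>]]
        D_chain[OF smooth_near_0_linear[OF M] hs diffeo_rep_0[OF h]]
        eventually_diffeo_rep[OF \<phi> hl] eventually_diffeo_rep[OF \<phi> diffeo_rep_inj_D[OF h]]
    proof eventually_elim
      case (elim x)
      have "D h (\<phi> x) (D \<phi> x v) = M (D h x v)" for v
        using fun_cong[OF elim(5), of v] fun_cong[OF elim(6), of v] elim(4) by (simp add: D_linear[OF M])
      then have "M (Y (h x)) = D h (\<phi> x) (D \<phi> x (X x))" using elim(1) by simp
      moreover have "- Y (M (h x)) = D h (\<phi> x) (- X (\<phi> x))"
        using elim(2,3) linear_neg[OF elim(7)] by simp
      ultimately show ?case using elim(8) by (simp add: inj_eq)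
    qed
  qed auto
  finally show ?thesis by (simp add: reversible_def)
qed

text \<open>
  \<open>B\<close> exchanges the two eigenspaces of \<open>M\<close>, so each of them is half of the space.
\<close>

lemma dim_fixed_space_anticommuting:
  fixes M B :: "r4 \<Rightarrow> r4"
  assumes M: "linear M" "\<And>v. M (M v) = v" and B: "linear B" "inj B" "\<And>v. M (B v) = - B (M v)"
  shows "dim {v. M v = v} = 2"
proof -
  let ?F = "{v. M v = v}" and ?N = "{v. M v = - v}"
  have sub: "subspace ?F" "subspace ?N"
    by (auto simp: subspace_def linear_0[OF M(1)] linear_add[OF M(1)] linear_scale[OF M(1)])
  have "dim (B ` ?F) \<le> dim ?N" "dim (B ` ?N) \<le> dim ?F"
    by (rule dim_subset; auto simp: B(3) linear_neg[OF B(1)])+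
  moreover have "dim (B ` S) = dim S" for S
    by (rule dim_image_eq) (use B in \<open>auto intro: inj_on_subset\<close>)
  ultimately have eq: "dim ?F = dim ?N" by simp
  have "{x + y |x y. x \<in> ?F \<and> y \<in> ?N} = UNIV"
  proof -
    have "\<exists>x y. v = x + y \<and> x \<in> ?F \<and> y \<in> ?N" for v
    proof (intro exI conjI)
      show "v = (1/2) *\<^sub>R (v + M v) + (1/2) *\<^sub>R (v - M v)"
        by (simp add: algebra_simps flip: scaleR_add_left)
      show "(1/2) *\<^sub>R (v + M v) \<in> ?F" "(1/2) *\<^sub>R (v - M v) \<in> ?N"
        by (simp_all add: linear_scale[OF M(1)] linear_add[OF M(1)] linear_diff[OF M(1)] M(2) algebra_simps)
    qed
    then show ?thesis by blast
  qed
  moreover have "?F \<inter> ?N = {0}"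
    using linear_0[OF M(1)] by (auto intro: eq_neg_imp_0)
  ultimately have "dim (UNIV :: r4 set) = dim ?F + dim ?N"
    using dim_sums_Int[OF sub] by simp
  then show ?thesis using eq by simp
qed

lemma funpow_conjugate:
  assumes h: "diffeo_rep h" and w: "diffeo_rep w" and conj: "\<forall>\<^sub>F x in nhds 0. h (w x) = W (h x)"
  shows "\<forall>\<^sub>F x in nhds 0. h ((w ^^ k) x) = (W ^^ k) (h x)"
proof (induction k)
  case (Suc k)
  from eventually_diffeo_rep[OF diffeo_rep_funpow[OF w] conj, of k] Suc show ?case
    by eventually_elim simp
qed simp

lemma linear_eq_if_eventually_eq:
  fixes f g :: "r4 \<Rightarrow> r4"
  assumes "linear f" "linear g" "\<forall>\<^sub>F x in nhds 0. f x = g x"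
  shows "f = g"
  using D_cong_0[OF assms(3)] by (simp add: D_linear assms(1,2))

text \<open>
  The linear data of the problem: \<open>P\<close> and \<open>Q\<close> are the derivatives of the involutions, and \<open>B\<close> is the linear
  part of the field.
\<close>

locale reversing_involutions =
  fixes P Q B :: "r4 \<Rightarrow> r4"
  assumes linP: "linear P" and linQ: "linear Q" and linB: "linear B" and injB: "inj B"
    and PP [simp]: "P (P x) = x" and QQ [simp]: "Q (Q x) = x"
    and PB: "P (B x) = - B (P x)" and QB: "Q (B x) = - B (Q x)"

definition dihedral_reversing_pair ::
  "nat \<Rightarrow> (r4 \<Rightarrow> r4) \<Rightarrow> (r4 \<Rightarrow> r4) \<Rightarrow> (r4 \<Rightarrow> r4) \<Rightarrow> bool" where
  "dihedral_reversing_pair n P Q B \<longleftrightarrow> reversing_involutions P Q B \<and>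
    (P \<circ> Q) ^^ n = id \<and> (\<forall>k. 0 < k \<and> k < n \<longrightarrow> (P \<circ> Q) ^^ k \<noteq> id)"

text \<open>
  The linear pair consists of the derivatives of the given involutions, and it anticommutes with the
  linear part of \<open>X\<close> itself. The maps \<open>\<phi>\<close> and \<open>\<psi>\<close> are kept in the conclusion so that \<open>h\<close> can still be
  followed by a linear change of coordinates.
\<close>

lemma dihedral_reversible_equivariant_linearize:
  assumes X: "vector_field_rep X" "inj (D X 0)" and n: "n \<ge> 2"
    and dih: "dihedral_reversible_equivariant n X"
  obtains h \<phi> \<psi> where "diffeo_rep h" "diffeo_rep \<phi>" "diffeo_rep \<psi>"
    "\<forall>\<^sub>F x in nhds 0. h (\<phi> x) = D \<phi> 0 (h x)" "\<forall>\<^sub>F x in nhds 0. h (\<psi> x) = D \<psi> 0 (h x)"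
    "reversible \<phi> X" "reversible \<psi> X" "dihedral_reversing_pair n (D \<phi> 0) (D \<psi> 0) (D X 0)"
proof -
  obtain \<phi> \<psi> where inv: "involution_rep \<phi>" "involution_rep \<psi>"
    and iso: "subgroup_generated diffeo_group {germ \<phi>, germ \<psi>} \<cong> dihedral_group n"
    and rev: "reversible \<phi> X" "reversible \<psi> X"
    using dih by (auto simp: dihedral_reversible_equivariant_def reversible_equivariant_def)
  have Xs: "smooth_near_0 X" "X 0 = 0" using X by (auto simp: vector_field_rep_def)
  have d: "diffeo_rep \<phi>" "diffeo_rep \<psi>" "diffeo_rep (\<lambda>x. \<phi> (\<psi> x))"
    and i: "\<forall>\<^sub>F x in nhds 0. \<phi> (\<phi> x) = x" "\<forall>\<^sub>F x in nhds 0. \<psi> (\<psi> x) = x"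
    using inv diffeo_rep_compose by (auto simp: involution_rep_def)
  note s = d(1,2)[THEN diffeo_rep_smooth] and z = d(1,2)[THEN diffeo_rep_0]
  let ?w = "\<lambda>x. \<phi> (\<psi> x)" and ?P = "D \<phi> 0" and ?Q = "D \<psi> 0"
  have ord: "\<forall>\<^sub>F x in nhds 0. (?w ^^ n) x = x" "\<And>k. 0 < k \<Longrightarrow> k < n \<Longrightarrow> \<not> (\<forall>\<^sub>F x in nhds 0. (?w ^^ k) x = x)"
    using generated_iso_dihedral_iff_order[OF inv n not_reversible_id[OF X(1) rev(1)] not_reversible_id[OF X(1) rev(2)]] iso
    by auto
  obtain h where h: "diffeo_rep h" and hP: "\<forall>\<^sub>F x in nhds 0. h (\<phi> x) = ?P (h x)"
    and hQ: "\<forall>\<^sub>F x in nhds 0. h (\<psi> x) = ?Q (h x)"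
    using linearize_two_involutions[OF inv _ ord(1)] n by auto
  have hw: "\<forall>\<^sub>F x in nhds 0. h (?w x) = (?P \<circ> ?Q) (h x)"
    using eventually_diffeo_rep[OF d(2) hP] hQ by eventually_elim simp
  have "(?P \<circ> ?Q) ^^ n = id"
  proof -
    have "D ?w 0 = ?P \<circ> ?Q" using D_chain_0[OF s z(2)] by (auto simp: z)
    then show ?thesis using D_funpow_0[OF d(3), of n] D_cong_0[OF ord(1)] by (simp add: id_def)
  qed
  moreover have "(?P \<circ> ?Q) ^^ k \<noteq> id" if "0 < k" "k < n" for k
  proof
    assume id: "(?P \<circ> ?Q) ^^ k = id"
    obtain g where g: "\<forall>\<^sub>F x in nhds 0. g (h x) = x" using diffeo_rep_inverse[OF h] by blast
    have "\<forall>\<^sub>F x in nhds 0. (?w ^^ k) x = x"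
      using funpow_conjugate[OF h d(3) hw, of k] g eventually_diffeo_rep[OF diffeo_rep_funpow[OF d(3)] g, of k]
      by eventually_elim (use id in \<open>metis id_apply\<close>)
    then show False using ord(2) that by blast
  qed
  moreover have "?P (?P v) = v" "?Q (?Q v) = v" for v
    using D_cong_0[OF i(1)] D_cong_0[OF i(2)] D_chain_0[OF s(1) s(1) z(1), of v] D_chain_0[OF s(2) s(2) z(2), of v]
    by simp_all
  moreover have "?P (D X 0 v) = - D X 0 (?P v)" "?Q (D X 0 v) = - D X 0 (?Q v)" for v
    using reversible_D_0[OF s(1) z(1) Xs rev(1)] reversible_D_0[OF s(2) z(2) Xs rev(2)] by auto
  ultimately have "dihedral_reversing_pair n ?P ?Q (D X 0)"
    using X(2) smooth_near_0_linear_D[OF s(1)] smooth_near_0_linear_D[OF s(2)] smooth_near_0_linear_D[OF Xs(1)]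
    by (simp add: dihedral_reversing_pair_def reversing_involutions_def)
  then show thesis by (rule that[OF h d(1,2) hP hQ rev])
qed

text \<open>
  The involutions are pulled back by \<open>h\<close>, and the powers of their product are the identity germ exactly
  when the corresponding powers of \<open>R \<circ> S\<close> are the identity. The coordinates \<open>h\<close> also straighten the fixed
  sets, whose dimension is 2 because \<open>R\<close> and \<open>S\<close> anticommute with the linear part of \<open>Y\<close>.
\<close>

lemma linear_dihedral_imp_dihedral_reversible_equivariant:
  assumes X: "vector_field_rep X" "inj (D X 0)" and n: "n \<ge> 2"
    and h: "diffeo_rep h" and XY: "in_coordinates h X Y" and Y: "vector_field_rep Y"
    and rev: "reversible R Y" "reversible S Y"
    and R: "linear R" "\<And>v. R (R v) = v" and S: "linear S" "\<And>v. S (S v) = v"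
    and W: "(R \<circ> S) ^^ n = id" "\<And>k. 0 < k \<Longrightarrow> k < n \<Longrightarrow> (R \<circ> S) ^^ k \<noteq> id"
  shows "dihedral_reversible_equivariant n X"
proof -
  obtain g where g: "diffeo_rep g" "\<forall>\<^sub>F x in nhds 0. g (h x) = x" "\<forall>\<^sub>F x in nhds 0. h (g x) = x"
    using diffeo_rep_inverse[OF h] .
  note hs = diffeo_rep_smooth[OF h] and h0 = diffeo_rep_0[OF h]
  have Xs: "smooth_near_0 X" "X 0 = 0" and Ys: "smooth_near_0 Y" "Y 0 = 0"
    using X Y by (auto simp: vector_field_rep_def)
  define B where "B = D Y 0"
  have B: "linear B" unfolding B_def by (rule smooth_near_0_linear_D[OF Ys(1)])
  have BX: "B (D h 0 v) = D h 0 (D X 0 v)" for v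
    using D_cong_0[OF XY[unfolded in_coordinates_def]] D_chain_0[OF Ys(1) hs h0, of v] D_D_apply_0[OF hs Xs, of v]
    by (simp add: B_def)
  have injB: "inj B"
  proof -
    have "v = 0" if "B v = 0" for v
    proof -
      obtain u where "v = D h 0 u"
        using linear_injective_imp_surjective[OF smooth_near_0_linear_D[OF hs] diffeo_rep_inj_D_0[OF h]]
        by (metis surjD)
      then have "D h 0 (D X 0 u) = 0" using that BX by simp
      then have "D X 0 u = 0"
        by (rule linear_inj_imp_0[OF smooth_near_0_linear_D[OF hs] diffeo_rep_inj_D_0[OF h]])
      then have "u = 0"
        by (rule linear_inj_imp_0[OF smooth_near_0_linear_D[OF Xs(1)] X(2)])
      then show ?thesis
        using \<open>v = D h 0 u\<close> by (simp add: linear_0[OF smooth_near_0_linear_D[OF hs]])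
    qed
    then show ?thesis by (rule linear_injI[OF B])
  qed
  have "\<exists>\<phi>. involution_rep \<phi> \<and> fix_has_dim \<phi> 2 \<and> reversible \<phi> X \<and> (\<forall>\<^sub>F x in nhds 0. h (\<phi> x) = M (h x))"
    if M: "linear M" "\<And>v. M (M v) = v" and Mr: "reversible M Y" for M
  proof -
    have injM: "inj M" by (metis M(2) injI)
    define \<phi> where "\<phi> x = g (M (h x))" for x
    have dM: "diffeo_rep (\<lambda>x. M (h x))"
      by (rule diffeo_rep_compose[OF diffeo_rep_linear[OF M(1) injM] h])
    have d\<phi>: "diffeo_rep \<phi>"
      using diffeo_rep_compose[OF g(1) dM] by (simp add: \<phi>_def[abs_def])
    have c: "\<forall>\<^sub>F x in nhds 0. h (\<phi> x) = M (h x)"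
      using eventually_diffeo_rep[OF dM g(3)] by (simp add: \<phi>_def)
    have "\<forall>\<^sub>F x in nhds 0. \<phi> (\<phi> x) = x"
      using c g(2) by eventually_elim (simp add: \<phi>_def[of "\<phi> _"] M)
    then have "involution_rep \<phi>" using d\<phi> by (simp add: involution_rep_def)
    moreover have "reversible \<phi> X"
      using reversible_in_coordinates[OF h XY d\<phi> M(1) c] Mr by simp
    moreover have "fix_has_dim \<phi> 2"
      unfolding fix_has_dim_def
    proof (intro exI conjI)
      show "diffeo_rep h" by (rule h)
      show "subspace {v. M v = v}"
        by (auto simp: subspace_def linear_0[OF M(1)] linear_add[OF M(1)] linear_scale[OF M(1)])
      have "M (B v) = - B (M v)" for v
        using reversible_D_0[OF smooth_near_0_linear[OF M(1)] linear_0[OF M(1)] Ys Mr]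
        by (simp add: D_linear[OF M(1)] B_def)
      then show "dim {v. M v = v} = 2"
        by (rule dim_fixed_space_anticommuting[OF M B injB])
      show "\<forall>\<^sub>F x in nhds 0. (\<phi> x = x) = (h x \<in> {v. M v = v})"
        using c g(2) by eventually_elim (auto simp: \<phi>_def)
    qed
    ultimately show ?thesis using c by blast
  qed
  note lift = this
  obtain \<phi> \<psi> where
    inv: "involution_rep \<phi>" "involution_rep \<psi>" and fd: "fix_has_dim \<phi> 2" "fix_has_dim \<psi> 2"
    and rv: "reversible \<phi> X" "reversible \<psi> X"
    and hR: "\<forall>\<^sub>F x in nhds 0. h (\<phi> x) = R (h x)" and hS: "\<forall>\<^sub>F x in nhds 0. h (\<psi> x) = S (h x)"
    using lift[OF R rev(1)] lift[OF S rev(2)] by auto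
  let ?w = "\<lambda>x. \<phi> (\<psi> x)"
  have d: "diffeo_rep \<psi>" "diffeo_rep ?w"
    using inv diffeo_rep_compose by (auto simp: involution_rep_def)
  have hw: "\<forall>\<^sub>F x in nhds 0. h (?w x) = (R \<circ> S) (h x)"
    using eventually_diffeo_rep[OF d(1) hR] hS by eventually_elim simp
  have lin: "linear ((R \<circ> S) ^^ k)" for k
    by (intro linear_funpow linear_compose R S)
  have "(\<forall>\<^sub>F x in nhds 0. (?w ^^ k) x = x) \<longleftrightarrow> (R \<circ> S) ^^ k = id" for k
  proof
    assume "\<forall>\<^sub>F x in nhds 0. (?w ^^ k) x = x"
    with funpow_conjugate[OF h d(2) hw, of k] have "\<forall>\<^sub>F x in nhds 0. ((R \<circ> S) ^^ k) (h x) = h x"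
      by eventually_elim metis
    from eventually_diffeo_rep[OF g(1) this] g(3) have "\<forall>\<^sub>F x in nhds 0. ((R \<circ> S) ^^ k) x = id x"
      by eventually_elim simp
    then show "(R \<circ> S) ^^ k = id" by (rule linear_eq_if_eventually_eq[OF lin linear_id])
  next
    assume id: "(R \<circ> S) ^^ k = id"
    show "\<forall>\<^sub>F x in nhds 0. (?w ^^ k) x = x"
      using funpow_conjugate[OF h d(2) hw, of k] g(2) eventually_diffeo_rep[OF diffeo_rep_funpow[OF d(2)] g(2), of k]
      by eventually_elim (use id in \<open>metis id_apply\<close>)
  qed
  then have "subgroup_generated diffeo_group {germ \<phi>, germ \<psi>} \<cong> dihedral_group n"
    using generated_iso_dihedral_iff_order[OF inv n not_reversible_id[OF X(1) rv(1)] not_reversible_id[OF X(1) rv(2)]] W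
    by simp
  then show ?thesis
    unfolding dihedral_reversible_equivariant_def reversible_equivariant_def using inv fd rv by blast
qed

section \<open>Normal forms of pairs of linear involutions\<close>

text \<open>
  On the plane spanned by \<open>v\<close> and \<open>u\<close>, in this basis, \<open>P\<close> has the matrix \<^const>\<open>mat_E\<close> and \<open>Q\<close> the
  matrix \<open>C\<close>.
\<close>

definition adapted_pair :: "real^2^2 \<Rightarrow> (r4 \<Rightarrow> r4) \<Rightarrow> (r4 \<Rightarrow> r4) \<Rightarrow> r4 \<Rightarrow> r4 \<Rightarrow> bool" where
  "adapted_pair C P Q v u \<longleftrightarrow> P v = v \<and> P u = - u \<and>
    Q v = C$1$1 *\<^sub>R v + C$2$1 *\<^sub>R u \<and> Q u = C$1$2 *\<^sub>R v + C$2$2 *\<^sub>R u"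

definition linearly_conjugate :: "(r4 \<Rightarrow> r4) \<Rightarrow> (r4 \<Rightarrow> r4) \<Rightarrow> real^4^4 \<Rightarrow> bool" where
  "linearly_conjugate P Q S \<longleftrightarrow>
    (\<exists>K. linear K \<and> inj K \<and> (\<forall>x. K (P x) = R0 *v K x) \<and> (\<forall>x. K (Q x) = S *v K x))"

lemma vector_4_nth [simp]:
  "(vector [a, b, c, d] :: 'a::zero^4) $ 1 = a" "(vector [a, b, c, d] :: 'a^4) $ 2 = b"
  "(vector [a, b, c, d] :: 'a^4) $ 3 = c" "(vector [a, b, c, d] :: 'a^4) $ 4 = d"
  by (simp_all add: vector_def)

lemma block_diag_mult_vec:
  "(block_diag B C *v x) $ 1 = B$1$1 * x$1 + B$1$2 * x$2"
  "(block_diag B C *v x) $ 2 = B$2$1 * x$1 + B$2$2 * x$2"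
  "(block_diag B C *v x) $ 3 = C$1$1 * x$3 + C$1$2 * x$4"
  "(block_diag B C *v x) $ 4 = C$2$1 * x$3 + C$2$2 * x$4"
  by (simp_all add: block_diag_def matrix_vector_mult_def sum_4)

lemma R0_eq_block_diag: "R0 = block_diag mat_E mat_E"
  by (simp add: R0_def block_diag_def mat_E_def)

text \<open>
  Since \<open>P\<close> fixes \<open>v\<close>, \<open>v'\<close> and negates \<open>u\<close>, \<open>u'\<close>, independence only has to be tested within these two
  eigenspaces. The four vectors are then a basis, and \<open>K\<close> takes coordinates with respect to it.
\<close>

lemma linearly_conjugate_if_adapted_pairs:
  assumes lin: "linear P" "linear Q"
    and pairs: "adapted_pair C P Q v u" "adapted_pair C' P Q v' u'"
    and indep: "\<And>a b. a *\<^sub>R v + b *\<^sub>R v' = 0 \<Longrightarrow> a = 0 \<and> b = 0"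
      "\<And>a b. a *\<^sub>R u + b *\<^sub>R u' = 0 \<Longrightarrow> a = 0 \<and> b = 0"
  shows "linearly_conjugate P Q (block_diag C C')"
proof -
  define L where "L x = x$1 *\<^sub>R v + x$2 *\<^sub>R u + x$3 *\<^sub>R v' + x$4 *\<^sub>R u'" for x :: r4
  have linL: "linear L"
    by (rule linearI) (simp_all add: L_def algebra_simps)
  note lin_simps = linear_add[OF lin(1)] linear_scale[OF lin(1)] linear_add[OF lin(2)] linear_scale[OF lin(2)]
  have PL: "P (L x) = L (R0 *v x)" for x
    using pairs by (simp add: L_def lin_simps adapted_pair_def R0_eq_block_diag block_diag_mult_vec mat_E_def)
  have QL: "Q (L x) = L (block_diag C C' *v x)" for x
    using pairs by (simp add: L_def lin_simps adapted_pair_def block_diag_mult_vec algebra_simps)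
  have "x = 0" if "L x = 0" for x
  proof -
    have "P (L x) = 0" using that linear_0[OF lin(1)] by simp
    then have "L (R0 *v x) = 0" by (simp add: PL)
    then have *: "x$1 *\<^sub>R v + x$3 *\<^sub>R v' - (x$2 *\<^sub>R u + x$4 *\<^sub>R u') = 0"
      by (simp add: L_def R0_eq_block_diag block_diag_mult_vec mat_E_def algebra_simps)
    have **: "x$1 *\<^sub>R v + x$3 *\<^sub>R v' = - (x$2 *\<^sub>R u + x$4 *\<^sub>R u')"
      using that by (simp add: L_def add_eq_0_iff2 algebra_simps)
    then have "x$2 *\<^sub>R u + x$4 *\<^sub>R u' = - (x$2 *\<^sub>R u + x$4 *\<^sub>R u')"
      using * by (simp only: right_minus_eq)
    then have "x$2 *\<^sub>R u + x$4 *\<^sub>R u' = 0"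
      by (rule eq_neg_imp_0)
    then have "x$2 = 0 \<and> x$4 = 0" by (rule indep(2))
    moreover from this have "x$1 *\<^sub>R v + x$3 *\<^sub>R v' = 0" using ** by simp
    then have "x$1 = 0 \<and> x$3 = 0" by (rule indep(1))
    ultimately show ?thesis by (simp add: vec_eq_iff forall_4)
  qed
  then have "inj L" by (rule linear_injI[OF linL])
  then obtain K where K: "linear K" "\<And>x. K (L x) = x" "\<And>x. L (K x) = x"
    using linear_injective_isomorphism[OF linL] by blast
  then have "inj K" by (metis injI)
  moreover have "K (P x) = R0 *v K x" "K (Q x) = block_diag C C' *v K x" for x
    using K PL[of "K x"] QL[of "K x"] by simp_all
  ultimately show ?thesis unfolding linearly_conjugate_def using K(1) by blast
qed

text \<open>
  For two planes of the same type the second vectors are obtained from the first by one injective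
  linear map, which preserves independence.
\<close>

lemma linearly_conjugate_if_uniform_pairs:
  assumes lin: "linear P" "linear Q" and U: "linear U" "inj U"
    and pairs: "adapted_pair C P Q v (U v)" "adapted_pair C P Q v' (U v')"
    and indep: "\<And>a b. a *\<^sub>R v + b *\<^sub>R v' = 0 \<Longrightarrow> a = 0 \<and> b = 0"
  shows "linearly_conjugate P Q (block_diag C C)"
proof (rule linearly_conjugate_if_adapted_pairs[OF lin pairs indep])
  fix a b assume "a *\<^sub>R U v + b *\<^sub>R U v' = 0"
  then have "U (a *\<^sub>R v + b *\<^sub>R v') = 0"
    by (simp add: linear_add[OF U(1)] linear_scale[OF U(1)])
  then show "a = 0 \<and> b = 0" by (rule indep[OF linear_inj_imp_0[OF U]])
qed

text \<open>
  For two planes of different type independence comes from a linear map \<open>N\<close>, a polynomial in \<open>P Q\<close> in the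
  applications, that vanishes on one plane and is a nonzero scalar on the other.
\<close>

lemma linearly_conjugate_if_separated_pairs:
  assumes lin: "linear P" "linear Q" and N: "linear N" "c \<noteq> 0"
    and pairs: "adapted_pair C P Q v u" "adapted_pair C' P Q v' u'"
    and N1: "N v = 0" "N u = 0" and N2: "N v' = c *\<^sub>R v'" "N u' = c *\<^sub>R u'"
    and nz: "v \<noteq> 0" "u \<noteq> 0" "v' \<noteq> 0" "u' \<noteq> 0"
  shows "linearly_conjugate P Q (block_diag C C')"
proof -
  have ind: "a = 0 \<and> b = 0"
    if "a *\<^sub>R x + b *\<^sub>R y = 0" "N x = 0" "N y = c *\<^sub>R y" "x \<noteq> 0" "y \<noteq> 0" for a b x y
  proof -
    have "N (a *\<^sub>R x + b *\<^sub>R y) = a *\<^sub>R N x + b *\<^sub>R N y"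
      by (simp only: linear_add[OF N(1)] linear_scale[OF N(1)])
    then have "b = 0" using that N(2) linear_0[OF N(1)] by simp
    then show ?thesis using that by simp
  qed
  show ?thesis
    by (rule linearly_conjugate_if_adapted_pairs[OF lin pairs])
      (erule ind[OF _ N1(1) N2(1) nz(1,3)], erule ind[OF _ N1(2) N2(2) nz(2,4)])
qed

context reversing_involutions
begin

lemmas lin_simps = linear_add[OF linP] linear_add[OF linQ] linear_add[OF linB]
  linear_diff[OF linP] linear_diff[OF linQ] linear_diff[OF linB]
  linear_neg[OF linP] linear_neg[OF linQ] linear_neg[OF linB]
  linear_scale[OF linP] linear_scale[OF linQ] linear_scale[OF linB]
  linear_0[OF linP] linear_0[OF linQ] linear_0[OF linB]

lemma B_nonzero: "v \<noteq> 0 \<Longrightarrow> B v \<noteq> 0"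
  using linear_inj_imp_0[OF linB injB] by metis

lemma Q_inj: "inj Q"
  by (metis QQ injI)

text \<open>
  An invariant subspace other than zero meets the fixed space of \<open>P\<close>: if \<open>x + P x\<close> vanishes, then \<open>P\<close>
  negates \<open>x\<close> and fixes \<open>B x\<close>.
\<close>

lemma fixed_vector:
  assumes "x \<in> Z" "x \<noteq> 0"
    and "\<And>x y. x \<in> Z \<Longrightarrow> y \<in> Z \<Longrightarrow> x + y \<in> Z" "\<And>x. x \<in> Z \<Longrightarrow> P x \<in> Z" "\<And>x. x \<in> Z \<Longrightarrow> B x \<in> Z"
  obtains v where "v \<in> Z" "v \<noteq> 0" "P v = v"
proof (cases "x + P x = 0")
  case True
  then have "P x = - x" by (simp add: add_eq_0_iff)
  then show thesis using that[of "B x"] assms B_nonzero by (simp add: PB lin_simps)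
next
  case False
  then show thesis using that[of "x + P x"] assms by (simp add: lin_simps add.commute)
qed

lemma second_fixed_vector:
  assumes "v \<noteq> 0" "P v = v"
  obtains v' where "P v' = v'" "\<And>a b. a *\<^sub>R v + b *\<^sub>R v' = 0 \<Longrightarrow> a = 0 \<and> b = 0"
proof -
  have "dim {x. P x = x} = 2"
    by (rule dim_fixed_space_anticommuting[OF linP PP linB injB PB])
  moreover have "dim (span {v}) \<le> 1"
    using dim_le_card'[of "{v}"] by simp
  ultimately have "\<not> {x. P x = x} \<subseteq> span {v}"
    using dim_subset[of "{x. P x = x}" "span {v}"] by linarith
  then obtain v' where v': "P v' = v'" "v' \<notin> span {v}" by blast
  have "a = 0 \<and> b = 0" if "a *\<^sub>R v + b *\<^sub>R v' = 0" for a b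
  proof -
    have "b = 0"
    proof (rule ccontr)
      assume "b \<noteq> 0"
      have "b *\<^sub>R v' = (- a) *\<^sub>R v" using that by (simp add: add_eq_0_iff)
      then have "inverse b *\<^sub>R (b *\<^sub>R v') = (inverse b * - a) *\<^sub>R v" by simp
      then have "v' = (inverse b * - a) *\<^sub>R v" using \<open>b \<noteq> 0\<close> by simp
      then show False using v'(2) span_scale[OF span_base[of v "{v}"]] by (metis singletonI)
    qed
    then show ?thesis using that assms by simp
  qed
  then show thesis using that v' by blast
qed

lemma eigenvector:
  assumes "P (Q x) = c *\<^sub>R x" "c * c = 1"
  shows "Q x = c *\<^sub>R P x" "P (Q (P x)) = c *\<^sub>R P x"
proof -
  show *: "Q x = c *\<^sub>R P x"
    using arg_cong[OF assms(1), of P] by (simp add: lin_simps)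
  have "x = c *\<^sub>R Q (P x)"
    using arg_cong[OF *, of Q] by (simp add: lin_simps)
  then have "c *\<^sub>R x = Q (P x)"
    using assms(2) by (metis scaleR_scaleR scaleR_one)
  then show "P (Q (P x)) = c *\<^sub>R P x"
    by (metis linear_scale[OF linP])
qed

lemma PQ_B: "P (Q (B x)) = B (P (Q x))"
  by (simp add: PB QB lin_simps)

text \<open>
  Eigenvectors of \<open>P Q\<close> with eigenvalue \<open>c = 1\<close> or \<open>c = -1\<close> can be chosen as common eigenvectors of \<open>P\<close> and \<open>Q\<close>;
  together with their images under \<open>B\<close> they span the planes on which \<open>Q\<close> is diagonal.
\<close>

lemma fixed_eigenvector:
  assumes "P (Q x) = c *\<^sub>R x" "c * c = 1" "x \<noteq> 0"
  obtains v where "v \<noteq> 0" "P v = v" "Q v = c *\<^sub>R v"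
proof -
  obtain v where "P (Q v) = c *\<^sub>R v" "v \<noteq> 0" "P v = v"
    using fixed_vector[of x "{x. P (Q x) = c *\<^sub>R x}"] assms eigenvector(2)[OF _ assms(2)]
    by (auto simp: lin_simps PQ_B scaleR_add_right)
  then show thesis using that eigenvector(1)[OF _ assms(2)] by metis
qed

lemma adapted_pair_E: "P v = v \<Longrightarrow> Q v = v \<Longrightarrow> adapted_pair mat_E P Q v (B v)"
  by (simp add: adapted_pair_def mat_E_def PB QB)

lemma adapted_pair_neg_E: "P v = v \<Longrightarrow> Q v = - v \<Longrightarrow> adapted_pair (- mat_E) P Q v (B v)"
  by (simp add: adapted_pair_def mat_E_def PB QB lin_simps)

text \<open>
  A fixed vector of \<open>P\<close> on which \<open>(P Q)^2 = -1\<close>. The sign \<open>s\<close> of the second basis vector is free, which is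
  why \<^const>\<open>mat_J\<close> and its negative are interchangeable.
\<close>

lemma adapted_pair_J:
  assumes "P v = v" "P (Q (P (Q v))) = - v" "s * s = 1"
  shows "adapted_pair (s *\<^sub>R mat_J) P Q v (s *\<^sub>R Q v)"
proof -
  have "P (Q v) = - Q v"
    using arg_cong[OF assms(2), of "\<lambda>x. Q (P x)"] assms(1) by (simp add: lin_simps)
  then show ?thesis using assms(1,3) by (simp add: adapted_pair_def mat_J_def lin_simps)
qed

lemma PQPQ_order_3: "P (Q (P (Q (P (Q x))))) = x \<Longrightarrow> P (Q (P (Q x))) = Q (P x)"
  by (drule arg_cong[of _ _ "\<lambda>x. Q (P x)"]) simp

text \<open>
  A fixed vector of \<open>P\<close> on which \<open>W^2 + W + 1 = 0\<close> for \<open>W = P Q\<close>. The second vector is found by solving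
  the first column of \<^const>\<open>mat_T\<close> for it.
\<close>

lemma adapted_pair_T:
  assumes "P v = v" "v + P (Q v) + P (Q (P (Q v))) = 0" "P (Q (P (Q (P (Q v))))) = v"
  shows "adapted_pair mat_T P Q v ((1 / sqrt 3) *\<^sub>R (2 *\<^sub>R Q v + v))"
proof -
  have "v + P (Q v) + Q v = 0" using assms(1,2) PQPQ_order_3[OF assms(3)] by simp
  then have *: "P (Q v) = - v - Q v" by (simp add: add_eq_0_iff algebra_simps)
  let ?u = "(1 / sqrt 3) *\<^sub>R (2 *\<^sub>R Q v + v)"
  have "P ?u = (1 / sqrt 3) *\<^sub>R (2 *\<^sub>R (- v - Q v) + v)"
    by (simp only: lin_simps * assms(1))
  also have "\<dots> = - ?u" by (simp add: vec_eq_iff field_simps)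
  finally have "P ?u = - ?u" .
  moreover have "Q v = (- 1 / 2) *\<^sub>R v + (sqrt 3 / 2) *\<^sub>R ?u"
    by (simp add: vec_eq_iff field_simps)
  moreover have "Q ?u = (sqrt 3 / 2) *\<^sub>R v + (1 / 2) *\<^sub>R ?u"
  proof -
    have "Q ?u = (1 / sqrt 3) *\<^sub>R (2 *\<^sub>R v + Q v)" by (simp only: lin_simps QQ)
    also have "\<dots> = (sqrt 3 / 2) *\<^sub>R v + (1 / 2) *\<^sub>R ?u" by (simp add: vec_eq_iff field_simps)
    finally show ?thesis .
  qed
  ultimately show ?thesis
    using assms(1) by (simp only: adapted_pair_def mat_T_def vector_2)
qed

end

text \<open>
  Here \<open>W = P Q\<close> is an involution other than the identity, so \<open>-1\<close> is an eigenvalue. Either \<open>W = -1\<close>, or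
  \<open>1\<close> is an eigenvalue too, and \<open>1 + W\<close> separates the two planes.
\<close>

lemma classify_order_2:
  assumes "reversing_involutions P Q B" and sq: "\<And>x. P (Q (P (Q x))) = x" and "\<exists>y. P (Q y) \<noteq> y"
  shows "linearly_conjugate P Q (block_diag (- mat_E) (- mat_E)) \<or>
    linearly_conjugate P Q (block_diag (- mat_E) mat_E)"
proof -
  interpret reversing_involutions P Q B by fact
  obtain y where "P (Q y) \<noteq> y" using assms by blast
  then have "P (Q (y - P (Q y))) = (- 1) *\<^sub>R (y - P (Q y))" "y - P (Q y) \<noteq> 0"
    by (simp_all add: lin_simps sq)
  from fixed_eigenvector[OF this(1) _ this(2)] obtain v where v: "v \<noteq> 0" "P v = v" "Q v = - v"
    by auto
  show ?thesis
  proof (cases "\<forall>x. P (Q x) = - x")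
    case True
    obtain v' where v': "P v' = v'" "\<And>a b. a *\<^sub>R v + b *\<^sub>R v' = 0 \<Longrightarrow> a = 0 \<and> b = 0"
      using second_fixed_vector[OF v(1,2)] by blast
    have "Q v' = - v'"
      using eigenvector(1)[of v' "- 1"] True v'(1) by simp
    then have "linearly_conjugate P Q (block_diag (- mat_E) (- mat_E))"
      by (rule linearly_conjugate_if_uniform_pairs[OF linP linQ linB injB
          adapted_pair_neg_E[OF v(2,3)] adapted_pair_neg_E[OF v'(1)] v'(2)])
    then show ?thesis ..
  next
    case False
    then obtain y where "P (Q y) \<noteq> - y" by blast
    then have "P (Q (y + P (Q y))) = 1 *\<^sub>R (y + P (Q y))" "y + P (Q y) \<noteq> 0"
      by (auto simp add: lin_simps sq add_eq_0_iff)
    from fixed_eigenvector[OF this(1) _ this(2)] obtain v' where v': "v' \<noteq> 0" "P v' = v'" "Q v' = v'"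
      by auto
    have lin: "linear (\<lambda>x. x + P (Q x))"
      by (rule linearI) (simp_all add: lin_simps algebra_simps)
    have "linearly_conjugate P Q (block_diag (- mat_E) mat_E)"
      by (rule linearly_conjugate_if_separated_pairs[OF linP linQ lin _ adapted_pair_neg_E[OF v(2,3)] adapted_pair_E[OF v'(2,3)], where c = 2])
        (simp_all add: v v' PQ_B lin_simps B_nonzero scaleR_2)
    then show ?thesis ..
  qed
qed

text \<open>
  For every \<open>y\<close> the vector \<open>y - W y\<close> lies in the kernel of \<open>N = 1 + W + W^2\<close>, and it is nonzero for some
  \<open>y\<close>. Either \<open>N = 0\<close>, or the values of \<open>N\<close> are fixed by \<open>W\<close>, and \<open>N\<close> is multiplication by 3 on them.
\<close>

lemma classify_order_3:
  assumes "reversing_involutions P Q B" and cube: "\<And>x. P (Q (P (Q (P (Q x))))) = x" and "\<exists>y. P (Q y) \<noteq> y"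
  shows "linearly_conjugate P Q (block_diag mat_T mat_T) \<or>
    linearly_conjugate P Q (block_diag mat_T mat_E)"
proof -
  interpret reversing_involutions P Q B by fact
  let ?N = "\<lambda>x. x + P (Q x) + P (Q (P (Q x)))"
  let ?U = "\<lambda>v. (1 / sqrt 3) *\<^sub>R (2 *\<^sub>R Q v + v)"
  have QPx: "P (Q (P (Q x))) = Q (P x)" for x by (rule PQPQ_order_3[OF cube])
  have QPQPx: "Q (P (Q (P x))) = P (Q x)" for x using arg_cong[OF cube[of x], of "\<lambda>x. Q (P (Q (P x)))"] by simp
  have linN: "linear ?N"
    by (rule linearI) (simp_all add: lin_simps algebra_simps)
  have linU: "linear ?U"
    by (rule linearI) (simp_all add: lin_simps algebra_simps)
  have U_nonzero: "x = 0" if "?U x = 0" for x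
  proof -
    have *: "2 *\<^sub>R Q x = - x" using that by (simp add: add_eq_0_iff2)
    then have "Q (2 *\<^sub>R Q x) = Q (- x)" by simp
    then have "2 *\<^sub>R x = - Q x" by (simp add: lin_simps)
    then have "2 *\<^sub>R (2 *\<^sub>R x) = - (2 *\<^sub>R Q x)" by simp
    then have "4 *\<^sub>R x = 1 *\<^sub>R x" unfolding * by simp
    then have "4 = (1::real) \<or> x = 0" by (simp only: scaleR_cancel_right)
    then show ?thesis by simp
  qed
  have injU: "inj ?U" by (rule linear_injI[OF linU U_nonzero])
  have NP: "?N (P x) = P (?N x)" for x
    by (simp add: lin_simps QPx QPQPx)
  have NB: "?N (B x) = B (?N x)" for x
    by (simp add: lin_simps PQ_B)
  obtain y where "P (Q y) \<noteq> y" using assms by blast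
  then have "y - P (Q y) \<in> {x. ?N x = 0}" "y - P (Q y) \<noteq> 0" by (simp_all add: lin_simps cube)
  from fixed_vector[OF this] obtain v where v: "?N v = 0" "v \<noteq> 0" "P v = v"
    using NP NB linear_0[OF linP] linear_0[OF linB] linear_add[OF linN] by auto
  note pT = adapted_pair_T[OF _ _ cube]
  show ?thesis
  proof (cases "\<forall>x. ?N x = 0")
    case True
    obtain v' where v': "P v' = v'" "\<And>a b. a *\<^sub>R v + b *\<^sub>R v' = 0 \<Longrightarrow> a = 0 \<and> b = 0"
      using second_fixed_vector[OF v(2,3)] by blast
    show ?thesis
      using linearly_conjugate_if_uniform_pairs[OF linP linQ linU injU pT[OF v(3,1)] pT[OF v'(1)] v'(2)] True by blast
  next
    case False
    then obtain y where "?N y \<noteq> 0" by blast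
    moreover have "P (Q (?N y)) = 1 *\<^sub>R ?N y"
      by (simp add: lin_simps cube)
    ultimately obtain v' where v': "v' \<noteq> 0" "P v' = v'" "Q v' = v'"
      using fixed_eigenvector[of "?N y" 1] by auto
    have "?N (Q v) = 0"
    proof -
      have "v + P (Q v) + Q v = 0" using v QPx by simp
      then show ?thesis by (simp add: v add.commute add.left_commute)
    qed
    moreover have "?N (?U v) = (1 / sqrt 3) *\<^sub>R (2 *\<^sub>R ?N (Q v) + ?N v)"
      by (simp only: linear_add[OF linN] linear_scale[OF linN])
    ultimately have "?N (?U v) = 0" using v(1) by simp
    moreover have "?U v \<noteq> 0" using U_nonzero v(2) by blast
    moreover have "?N v' = 3 *\<^sub>R v'"
      using scaleR_add_left[of 2 1 v'] v'(2,3) by (simp add: scaleR_2)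
    moreover from this have "?N (B v') = 3 *\<^sub>R B v'" by (simp only: NB linear_scale[OF linB])
    ultimately have "linearly_conjugate P Q (block_diag mat_T mat_E)"
      using linearly_conjugate_if_separated_pairs[OF linP linQ linN _ pT[OF v(3,1)] adapted_pair_E[OF v'(2,3)], of 3]
        v(1,2) v'(1) B_nonzero by simp
    then show ?thesis ..
  qed
qed

text \<open>
  For every \<open>y\<close> the vector \<open>y - W^2 y\<close> lies in the kernel of \<open>N = 1 + W^2\<close>, and it is nonzero for some
  \<open>y\<close>. If \<open>N\<close> does not vanish, then \<open>z = y + W^2 y\<close> satisfies \<open>W^2 z = z\<close>, and one of the eigenvalues
  \<open>1\<close> (if \<open>z + W z \<noteq> 0\<close>) and \<open>-1\<close> (otherwise) gives the second plane.
\<close>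

lemma classify_order_4:
  assumes "reversing_involutions P Q B" and four: "\<And>x. P (Q (P (Q (P (Q (P (Q x))))))) = x"
    and "\<exists>y. P (Q (P (Q y))) \<noteq> y"
  shows "(\<forall>C\<in>{mat_J, - mat_J}. linearly_conjugate P Q (block_diag C C)) \<or>
    (\<forall>C\<in>{mat_J, - mat_J}. linearly_conjugate P Q (block_diag C mat_E)) \<or>
    (\<forall>C\<in>{mat_J, - mat_J}. linearly_conjugate P Q (block_diag C (- mat_E)))"
proof -
  interpret reversing_involutions P Q B by fact
  let ?N = "\<lambda>x. x + P (Q (P (Q x)))"
  have J_cases: "\<exists>s. C = s *\<^sub>R mat_J \<and> s * s = 1" if "C \<in> {mat_J, - mat_J}" for C
  proof -
    from that consider "C = mat_J" | "C = - mat_J" by blast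
    then show ?thesis
      by cases (rule exI[of _ 1], simp, rule exI[of _ "- 1"], simp)
  qed
  have linN: "linear ?N"
    by (rule linearI) (simp_all add: lin_simps algebra_simps)
  have inv: "P (Q (P (Q (P x)))) = - P x" if "P (Q (P (Q x))) = - x" for x
  proof -
    have "Q (P (Q (P x))) = - x"
      using arg_cong[OF that, of "\<lambda>x. Q (P (Q (P x)))"] by (simp add: lin_simps equation_minus_iff)
    then show ?thesis by (simp add: lin_simps)
  qed
  obtain y where "P (Q (P (Q y))) \<noteq> y" using assms by blast
  then have "y - P (Q (P (Q y))) \<in> {x. P (Q (P (Q x))) = - x}" "y - P (Q (P (Q y))) \<noteq> 0"
    by (simp_all add: lin_simps four)
  from fixed_vector[OF this] obtain v where v: "P (Q (P (Q v))) = - v" "v \<noteq> 0" "P v = v"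
    by (auto simp: lin_simps PQ_B inv)
  have lin_sQ: "linear (\<lambda>x. s *\<^sub>R Q x)" for s
    by (rule linearI) (simp_all add: lin_simps algebra_simps)
  have Q_nonzero: "Q v \<noteq> 0" using v(2) linear_inj_imp_0[OF linQ Q_inj] by metis
  have PQv: "P (Q v) = - Q v"
    using adapted_pair_J[OF v(3,1), of 1] by (simp add: adapted_pair_def)
  show ?thesis
  proof (cases "\<forall>x. P (Q (P (Q x))) = - x")
    case True
    obtain v' where v': "P v' = v'" "\<And>a b. a *\<^sub>R v + b *\<^sub>R v' = 0 \<Longrightarrow> a = 0 \<and> b = 0"
      using second_fixed_vector[OF v(2,3)] by blast
    have "linearly_conjugate P Q (block_diag C C)" if C: "C \<in> {mat_J, - mat_J}" for C
    proof -
      obtain s where s: "C = s *\<^sub>R mat_J" "s * s = 1" using J_cases[OF C] by blast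
      have "s \<noteq> 0" using s(2) by auto
      then have inj: "inj (\<lambda>x. s *\<^sub>R Q x)"
        using injD[OF Q_inj] by (intro injI) simp
      have W: "P (Q (P (Q v'))) = - v'" using True by blast
      show ?thesis
        unfolding s(1)
        by (rule linearly_conjugate_if_uniform_pairs[OF linP linQ lin_sQ inj adapted_pair_J[OF v(3,1) s(2)] adapted_pair_J[OF v'(1) W s(2)] v'(2)])
    qed
    then show ?thesis by blast
  next
    case False
    then obtain y where y: "P (Q (P (Q y))) \<noteq> - y" by blast
    define z where "z = y + P (Q (P (Q y)))"
    have z: "z \<noteq> 0" "P (Q (P (Q z))) = z"
      using y by (simp_all add: z_def lin_simps four add_eq_0_iff add.commute)
    have sep: "linearly_conjugate P Q (block_diag C C')"
      if C: "C \<in> {mat_J, - mat_J}" and p: "adapted_pair C' P Q v' (B v')" and v': "P (Q (P (Q v'))) = v'" "v' \<noteq> 0"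
      for C C' v'
    proof -
      obtain s where s: "C = s *\<^sub>R mat_J" "s * s = 1" using J_cases[OF C] by blast
      have "s \<noteq> 0" using s(2) by auto
      have "?N (s *\<^sub>R Q v) = 0" by (simp add: lin_simps PQv v(3))
      moreover have "?N (B v') = 2 *\<^sub>R B v'" by (simp add: PQ_B v'(1) scaleR_2)
      ultimately show ?thesis
        unfolding s(1) using v(1,2) v' \<open>s \<noteq> 0\<close> Q_nonzero B_nonzero[OF v'(2)]
        by (intro linearly_conjugate_if_separated_pairs[OF linP linQ linN _ adapted_pair_J[OF v(3,1) s(2)] p, where c = 2])
          (simp_all add: scaleR_2)
    qed
    show ?thesis
    proof (cases "z + P (Q z) = 0")
      case True
      then have "P (Q z) = (- 1) *\<^sub>R z" by (simp add: add_eq_0_iff)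
      from fixed_eigenvector[OF this _ z(1)] obtain v' where v': "v' \<noteq> 0" "P v' = v'" "Q v' = - v'"
        by auto
      have "linearly_conjugate P Q (block_diag C (- mat_E))" if "C \<in> {mat_J, - mat_J}" for C
        by (rule sep[OF that adapted_pair_neg_E[OF v'(2,3)] _ v'(1)]) (simp add: v' lin_simps)
      then show ?thesis by blast
    next
      case False
      have "P (Q (z + P (Q z))) = 1 *\<^sub>R (z + P (Q z))" using z(2) by (simp add: lin_simps add.commute)
      from fixed_eigenvector[OF this _ False] obtain v' where v': "v' \<noteq> 0" "P v' = v'" "Q v' = v'"
        by auto
      have "linearly_conjugate P Q (block_diag C mat_E)" if "C \<in> {mat_J, - mat_J}" for C
        by (rule sep[OF that adapted_pair_E[OF v'(2,3)] _ v'(1)]) (simp add: v')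
      then show ?thesis by blast
    qed
  qed
qed

section \<open>The model involutions\<close>

lemma block_diag_matrix_mult:
  "block_diag A B ** block_diag A' B' = block_diag (A ** A') (B ** B')"
  by (simp add: block_diag_def vec_eq_iff forall_4 matrix_matrix_mult_def sum_4 sum_2)

lemma block_diag_eq_mat_1: "block_diag A B = mat 1 \<longleftrightarrow> A = mat 1 \<and> B = mat 1"
  by (auto simp: block_diag_def vec_eq_iff forall_4 forall_2 mat_def)

definition block_power :: "nat \<Rightarrow> real^2^2 \<Rightarrow> real^2^2" where
  "block_power k C = ((**) (mat_E ** C) ^^ k) (mat 1)"

lemma R0_block_diag_funpow:
  "((*v) R0 \<circ> (*v) (block_diag C C')) ^^ k = (*v) (block_diag (block_power k C) (block_power k C'))"
proof (induction k)
  case 0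
  have "block_diag (mat 1) (mat 1) = mat 1" by (simp add: block_diag_eq_mat_1)
  then show ?case by (simp add: block_power_def fun_eq_iff)
next
  case (Suc k)
  then show ?case
    by (simp add: block_power_def fun_eq_iff R0_eq_block_diag matrix_vector_mul_assoc
      block_diag_matrix_mult matrix_mul_assoc)
qed

lemma matrix_vector_mul_eq_id: "(*v) A = id \<longleftrightarrow> A = mat 1" for A :: "real^'n^'n"
  by (metis eq_id_iff matrix_eq matrix_vector_mul_lid)

text \<open>
  In each block the two involutions are the reflections \<^const>\<open>mat_E\<close> and \<open>C\<close>. For the product \<open>R0 S\<close> to have
  order \<open>n\<close>, the \<open>n\<close>-th power must be trivial in both blocks, but a single block is enough to
  exclude the smaller powers.
\<close>

definition dihedral_reflection :: "nat \<Rightarrow> real^2^2 \<Rightarrow> bool" where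
  "dihedral_reflection n C \<longleftrightarrow> C ** C = mat 1 \<and> block_power n C = mat 1"

definition faithful_reflection :: "nat \<Rightarrow> real^2^2 \<Rightarrow> bool" where
  "faithful_reflection n C \<longleftrightarrow> (\<forall>k. 0 < k \<and> k < n \<longrightarrow> block_power k C \<noteq> mat 1)"

lemmas block_simps = vec_eq_iff forall_2 matrix_matrix_mult_def sum_2 mat_def mat_E_def mat_J_def mat_T_def

lemma dihedral_reflections:
  "dihedral_reflection n mat_E" "dihedral_reflection 2 (- mat_E)" "dihedral_reflection 4 (- mat_E)"
  "dihedral_reflection 3 mat_T" "dihedral_reflection 4 mat_J" "dihedral_reflection 4 (- mat_J)"
proof -
  have "mat_E ** mat_E = mat 1" by (simp add: block_simps)
  moreover from this have "block_power n mat_E = mat 1"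
    by (induction n) (simp_all add: block_power_def)
  ultimately show "dihedral_reflection n mat_E" by (simp add: dihedral_reflection_def)
qed (simp_all add: dihedral_reflection_def block_power_def eval_nat_numeral, simp_all add: block_simps field_simps)

lemma faithful_reflections:
  "faithful_reflection 2 (- mat_E)" "faithful_reflection 3 mat_T"
  "faithful_reflection 4 mat_J" "faithful_reflection 4 (- mat_J)"
proof -
  have 2: "0 < k \<and> k < 2 \<longleftrightarrow> k = 1" and 3: "0 < k \<and> k < 3 \<longleftrightarrow> k = 1 \<or> k = 2"
    and 4: "0 < k \<and> k < 4 \<longleftrightarrow> k = 1 \<or> k = 2 \<or> k = 3" for k :: nat
    by auto
  show "faithful_reflection 2 (- mat_E)"
    unfolding faithful_reflection_def 2 by (simp add: block_power_def) (simp add: block_simps)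
  show "faithful_reflection 3 mat_T"
    unfolding faithful_reflection_def 3 by (auto simp add: block_power_def eval_nat_numeral) (auto simp add: block_simps)
  show "faithful_reflection 4 mat_J" "faithful_reflection 4 (- mat_J)"
    unfolding faithful_reflection_def 4 by (auto simp add: block_power_def eval_nat_numeral) (auto simp add: block_simps)
qed

section \<open>The classification\<close>

lemma vf_reps_iff:
  "X \<in> vf_reps \<alpha> \<beta> \<longleftrightarrow> vector_field_rep X \<and> D X 0 = (*v) (linear_part \<alpha> \<beta>)"
proof -
  have "(X has_derivative D X 0) (at 0)" if "vector_field_rep X"
    using that smooth_near_0_has_derivative_0 by (simp add: vector_field_rep_def)
  then show ?thesis
    by (auto simp: vf_reps_def dest: frechet_derivative_at)
qed

lemma inj_linear_part: "\<alpha> * \<beta> \<noteq> 0 \<Longrightarrow> inj ((*v) (linear_part \<alpha> \<beta>))"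
  by (rule linear_injI)
    (auto simp: vec_eq_iff forall_4 matrix_vector_mult_def sum_4 linear_part_def)

lemma Omega_block_diag_subset:
  assumes ab: "\<alpha> * \<beta> \<noteq> 0" and n: "n \<ge> 2"
    and C: "dihedral_reflection n C" "dihedral_reflection n C'"
    and faith: "faithful_reflection n C \<or> faithful_reflection n C'"
  shows "Omega \<alpha> \<beta> (block_diag C C') \<subseteq> Omega_D n \<alpha> \<beta>"
proof -
  have "dihedral_reversible_equivariant n X"
    if X: "X \<in> vf_reps \<alpha> \<beta>" and h: "diffeo_rep h" and Y: "in_coordinates h X Y" "vector_field_rep Y"
      and rev: "reversible_equivariant ((*v) R0) ((*v) (block_diag C C')) Y" for X h Y
  proof (rule linear_dihedral_imp_dihedral_reversible_equivariant)
    have invol: "block_diag A A' *v (block_diag A A' *v v) = v"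
      if "A ** A = mat 1" "A' ** A' = mat 1" for A A' v
    proof -
      have "block_diag (mat 1) (mat 1) = mat 1" by (simp add: block_diag_eq_mat_1)
      then show ?thesis by (simp add: matrix_vector_mul_assoc block_diag_matrix_mult that)
    qed
    show "R0 *v (R0 *v v) = v" for v
      using dihedral_reflections(1) unfolding R0_eq_block_diag dihedral_reflection_def by (intro invol) auto
    show "block_diag C C' *v (block_diag C C' *v v) = v" for v
      using C unfolding dihedral_reflection_def by (intro invol) auto
    show "((*v) R0 \<circ> (*v) (block_diag C C')) ^^ n = id"
      using C by (simp only: R0_block_diag_funpow matrix_vector_mul_eq_id block_diag_eq_mat_1 dihedral_reflection_def)
    show "((*v) R0 \<circ> (*v) (block_diag C C')) ^^ k \<noteq> id" if "0 < k" "k < n" for k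
      using faith that by (auto simp only: R0_block_diag_funpow matrix_vector_mul_eq_id block_diag_eq_mat_1 faithful_reflection_def)
  qed (use X h Y rev n inj_linear_part[OF ab] in \<open>auto simp: vf_reps_iff reversible_equivariant_def\<close>)
  then show ?thesis unfolding Omega_def Omega_D_def by blast
qed

text \<open>
  The linearising coordinates are followed by the linear conjugation to the normal form, so that there is
  only one change of coordinates, from \<open>X\<close> to \<open>Y\<close>.
\<close>

lemma Omega_D_subset:
  assumes ab: "\<alpha> * \<beta> \<noteq> 0" and n: "n \<ge> 2"
    and conj: "\<And>P Q B. dihedral_reversing_pair n P Q B \<Longrightarrow> \<exists>S\<in>\<S>. linearly_conjugate P Q S"
  shows "Omega_D n \<alpha> \<beta> \<subseteq> (\<Union>S\<in>\<S>. Omega \<alpha> \<beta> S)"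
proof -
  have "\<exists>S\<in>\<S>. \<exists>h Y. diffeo_rep h \<and> in_coordinates h X Y \<and> vector_field_rep Y \<and>
      reversible_equivariant ((*v) R0) ((*v) S) Y"
    if X: "X \<in> vf_reps \<alpha> \<beta>" and dih: "dihedral_reversible_equivariant n X" for X
  proof -
    have Xv: "vector_field_rep X" and injX: "inj (D X 0)"
      using X inj_linear_part[OF ab] by (simp_all add: vf_reps_iff)
    obtain h \<phi> \<psi> where h: "diffeo_rep h" "diffeo_rep \<phi>" "diffeo_rep \<psi>"
      and conj_\<phi>: "\<forall>\<^sub>F x in nhds 0. h (\<phi> x) = D \<phi> 0 (h x)"
      and conj_\<psi>: "\<forall>\<^sub>F x in nhds 0. h (\<psi> x) = D \<psi> 0 (h x)"
      and rev: "reversible \<phi> X" "reversible \<psi> X"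
      and pair: "dihedral_reversing_pair n (D \<phi> 0) (D \<psi> 0) (D X 0)"
      using dihedral_reversible_equivariant_linearize[OF Xv injX n dih] .
    obtain S K where S: "S \<in> \<S>" and K: "linear K" "inj K"
      "\<And>x. K (D \<phi> 0 x) = R0 *v K x" "\<And>x. K (D \<psi> 0 x) = S *v K x"
      using conj[OF pair] unfolding linearly_conjugate_def by blast
    let ?k = "\<lambda>x. K (h x)"
    have k: "diffeo_rep ?k"
      by (rule diffeo_rep_compose[OF diffeo_rep_linear[OF K(1,2)] h(1)])
    obtain Y where Y: "vector_field_rep Y" "in_coordinates ?k X Y"
      using vector_field_in_coordinates[OF k Xv] .
    have "\<forall>\<^sub>F x in nhds 0. ?k (\<phi> x) = R0 *v ?k x"
      using conj_\<phi> by eventually_elim (simp add: K)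
    then have "reversible ((*v) R0) Y"
      using reversible_in_coordinates[OF k Y(2) h(2) matrix_vector_mul_linear] rev(1) by blast
    moreover have "\<forall>\<^sub>F x in nhds 0. ?k (\<psi> x) = S *v ?k x"
      using conj_\<psi> by eventually_elim (simp add: K)
    then have "reversible ((*v) S) Y"
      using reversible_in_coordinates[OF k Y(2) h(3) matrix_vector_mul_linear] rev(2) by blast
    ultimately show ?thesis using S k Y unfolding reversible_equivariant_def by blast
  qed
  then show ?thesis unfolding Omega_def Omega_D_def by blast
qed

lemma dihedral_reversing_pairD:
  assumes "dihedral_reversing_pair n P Q B"
  shows "reversing_involutions P Q B" "(P \<circ> Q) ^^ n = id"
    and "0 < k \<Longrightarrow> k < n \<Longrightarrow> \<exists>y. ((P \<circ> Q) ^^ k) y \<noteq> y"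
  using assms by (auto simp: dihedral_reversing_pair_def fun_eq_iff)

lemma Omega_D_2:
  assumes ab: "\<alpha> * \<beta> \<noteq> 0"
  shows "Omega_D 2 \<alpha> \<beta> =
       Omega \<alpha> \<beta> (block_diag (- mat_E) (- mat_E)) \<union>
       Omega \<alpha> \<beta> (block_diag (- mat_E) mat_E) \<union>
       Omega \<alpha> \<beta> (block_diag mat_E (- mat_E))"
proof (intro antisym Un_least)
  have "Omega_D 2 \<alpha> \<beta> \<subseteq> (\<Union>S\<in>{block_diag (- mat_E) (- mat_E), block_diag (- mat_E) mat_E}. Omega \<alpha> \<beta> S)"
  proof (rule Omega_D_subset[OF ab])
    fix P Q B assume pair: "dihedral_reversing_pair 2 P Q B"
    have "P (Q (P (Q x))) = x" for x
      using fun_cong[OF dihedral_reversing_pairD(2)[OF pair], of x] by (simp add: eval_nat_numeral)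
    moreover have "\<exists>y. P (Q y) \<noteq> y"
      using dihedral_reversing_pairD(3)[OF pair, of 1] by simp
    ultimately show "\<exists>S\<in>{block_diag (- mat_E) (- mat_E), block_diag (- mat_E) mat_E}. linearly_conjugate P Q S"
      using classify_order_2[OF dihedral_reversing_pairD(1)[OF pair]] by simp
  qed simp
  then show "Omega_D 2 \<alpha> \<beta> \<subseteq>
       Omega \<alpha> \<beta> (block_diag (- mat_E) (- mat_E)) \<union>
       Omega \<alpha> \<beta> (block_diag (- mat_E) mat_E) \<union>
       Omega \<alpha> \<beta> (block_diag mat_E (- mat_E))" by blast
qed (intro Omega_block_diag_subset[OF ab]; simp add: dihedral_reflections faithful_reflections)+

lemma Omega_D_3:
  assumes ab: "\<alpha> * \<beta> \<noteq> 0"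
  shows "Omega_D 3 \<alpha> \<beta> =
       Omega \<alpha> \<beta> (block_diag mat_T mat_T) \<union>
       Omega \<alpha> \<beta> (block_diag mat_T mat_E) \<union>
       Omega \<alpha> \<beta> (block_diag mat_E mat_T)"
proof (intro antisym Un_least)
  have "Omega_D 3 \<alpha> \<beta> \<subseteq> (\<Union>S\<in>{block_diag mat_T mat_T, block_diag mat_T mat_E}. Omega \<alpha> \<beta> S)"
  proof (rule Omega_D_subset[OF ab])
    fix P Q B assume pair: "dihedral_reversing_pair 3 P Q B"
    have "P (Q (P (Q (P (Q x))))) = x" for x
      using fun_cong[OF dihedral_reversing_pairD(2)[OF pair], of x] by (simp add: eval_nat_numeral)
    moreover have "\<exists>y. P (Q y) \<noteq> y"
      using dihedral_reversing_pairD(3)[OF pair, of 1] by simp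
    ultimately show "\<exists>S\<in>{block_diag mat_T mat_T, block_diag mat_T mat_E}. linearly_conjugate P Q S"
      using classify_order_3[OF dihedral_reversing_pairD(1)[OF pair]] by simp
  qed simp
  then show "Omega_D 3 \<alpha> \<beta> \<subseteq>
       Omega \<alpha> \<beta> (block_diag mat_T mat_T) \<union>
       Omega \<alpha> \<beta> (block_diag mat_T mat_E) \<union>
       Omega \<alpha> \<beta> (block_diag mat_E mat_T)" by blast
qed (intro Omega_block_diag_subset[OF ab]; simp add: dihedral_reflections faithful_reflections)+

lemma Omega_D_4_subset:
  assumes ab: "\<alpha> * \<beta> \<noteq> 0" and signs: "C1 \<in> {mat_J, - mat_J}" "C2 \<in> {mat_J, - mat_J}" "C3 \<in> {mat_J, - mat_J}"
  shows "Omega_D 4 \<alpha> \<beta> \<subseteq>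
    Omega \<alpha> \<beta> (block_diag C1 mat_E) \<union> Omega \<alpha> \<beta> (block_diag C2 C2) \<union> Omega \<alpha> \<beta> (block_diag C3 (- mat_E))"
proof -
  let ?S = "{block_diag C1 mat_E, block_diag C2 C2, block_diag C3 (- mat_E)}"
  have "Omega_D 4 \<alpha> \<beta> \<subseteq> (\<Union>S\<in>?S. Omega \<alpha> \<beta> S)"
  proof (rule Omega_D_subset[OF ab])
    fix P Q B assume pair: "dihedral_reversing_pair 4 P Q B"
    have "P (Q (P (Q (P (Q (P (Q x))))))) = x" for x
      using fun_cong[OF dihedral_reversing_pairD(2)[OF pair], of x] by (simp add: eval_nat_numeral)
    moreover have "\<exists>y. P (Q (P (Q y))) \<noteq> y"
      using dihedral_reversing_pairD(3)[OF pair, of 2] by (simp add: eval_nat_numeral)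
    ultimately show "\<exists>S\<in>?S. linearly_conjugate P Q S"
      using classify_order_4[OF dihedral_reversing_pairD(1)[OF pair]] signs by blast
  qed simp
  then show ?thesis by blast
qed

theorem theoremA:
  fixes \<alpha> \<beta> :: real
  assumes "\<alpha> * \<beta> \<noteq> 0"
  shows
    "Omega_D 2 \<alpha> \<beta> =
       Omega \<alpha> \<beta> (block_diag (- mat_E) (- mat_E)) \<union>
       Omega \<alpha> \<beta> (block_diag (- mat_E) mat_E) \<union>
       Omega \<alpha> \<beta> (block_diag mat_E (- mat_E))
   \<and> Omega_D 3 \<alpha> \<beta> =
       Omega \<alpha> \<beta> (block_diag mat_T mat_T) \<union>
       Omega \<alpha> \<beta> (block_diag mat_T mat_E) \<union>
       Omega \<alpha> \<beta> (block_diag mat_E mat_T)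
   \<and> (\<forall>S1 \<in> {block_diag (- mat_J) mat_E, block_diag mat_J mat_E}.
      \<forall>S2 \<in> {block_diag (- mat_E) mat_J, block_diag (- mat_E) (- mat_J)}.
      \<forall>S3 \<in> {block_diag mat_E mat_J, block_diag mat_E (- mat_J)}.
      \<forall>S4 \<in> {block_diag mat_J mat_J, block_diag (- mat_J) (- mat_J)}.
      \<forall>S5 \<in> {block_diag mat_J (- mat_E), block_diag (- mat_J) (- mat_E)}.
      \<forall>S6 \<in> {block_diag mat_J (- mat_J), block_diag (- mat_J) mat_J}.
        Omega_D 4 \<alpha> \<beta> =
          Omega \<alpha> \<beta> S1 \<union> Omega \<alpha> \<beta> S2 \<union> Omega \<alpha> \<beta> S3 \<union>
          Omega \<alpha> \<beta> S4 \<union> Omega \<alpha> \<beta> S5 \<union> Omega \<alpha> \<beta> S6)"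
proof (intro conjI ballI)
  show "Omega_D 2 \<alpha> \<beta> =
       Omega \<alpha> \<beta> (block_diag (- mat_E) (- mat_E)) \<union>
       Omega \<alpha> \<beta> (block_diag (- mat_E) mat_E) \<union>
       Omega \<alpha> \<beta> (block_diag mat_E (- mat_E))"
    by (rule Omega_D_2[OF assms])
  show "Omega_D 3 \<alpha> \<beta> =
       Omega \<alpha> \<beta> (block_diag mat_T mat_T) \<union>
       Omega \<alpha> \<beta> (block_diag mat_T mat_E) \<union>
       Omega \<alpha> \<beta> (block_diag mat_E mat_T)"
    by (rule Omega_D_3[OF assms])
  fix S1 S2 S3 S4 S5 S6
  assume S1: "S1 \<in> {block_diag (- mat_J) mat_E, block_diag mat_J mat_E}"
    and S2: "S2 \<in> {block_diag (- mat_E) mat_J, block_diag (- mat_E) (- mat_J)}"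
    and S3: "S3 \<in> {block_diag mat_E mat_J, block_diag mat_E (- mat_J)}"
    and S4: "S4 \<in> {block_diag mat_J mat_J, block_diag (- mat_J) (- mat_J)}"
    and S5: "S5 \<in> {block_diag mat_J (- mat_E), block_diag (- mat_J) (- mat_E)}"
    and S6: "S6 \<in> {block_diag mat_J (- mat_J), block_diag (- mat_J) mat_J}"
  note sub = Omega_block_diag_subset[OF assms, of 4]
  note reflections = dihedral_reflections faithful_reflections
  have "Omega \<alpha> \<beta> S \<subseteq> Omega_D 4 \<alpha> \<beta>" if "S \<in> {S1, S2, S3, S4, S5, S6}" for S
    using that S1 S2 S3 S4 S5 S6 by (elim insertE emptyE) (simp_all add: sub reflections)
  moreover obtain C1 where "C1 \<in> {mat_J, - mat_J}" "S1 = block_diag C1 mat_E" using S1 by blast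
  moreover obtain C4 where "C4 \<in> {mat_J, - mat_J}" "S4 = block_diag C4 C4" using S4 by blast
  moreover obtain C5 where "C5 \<in> {mat_J, - mat_J}" "S5 = block_diag C5 (- mat_E)" using S5 by blast
  ultimately show "Omega_D 4 \<alpha> \<beta> =
          Omega \<alpha> \<beta> S1 \<union> Omega \<alpha> \<beta> S2 \<union> Omega \<alpha> \<beta> S3 \<union>
          Omega \<alpha> \<beta> S4 \<union> Omega \<alpha> \<beta> S5 \<union> Omega \<alpha> \<beta> S6"
    using Omega_D_4_subset[OF assms, of C1 C4 C5] by blast
qed

end
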